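(* Let $X$ be a finite dimensional CAT(0) cube complex. Then $X$ (that is, its vertex set with the edge-path metric) has Property A.
   Context: A cube complex is a polyhedral complex in which the cells are Euclidean cubes of side length one, the attaching maps are isometries identifying the faces of a given cube with cubes of lower dimension, and the intersection of two cubes is a common face of each. It is finite dimensional if there is a bound on the dimension of its cubes. It is a CAT(0) cube complex if the underlying topological space is simply connected and the complex satisfies Gromov's link condition (the link of every vertex is a flag simplicial complex); in the finite-dimensional case this is equivalent to the natural geodesic metric satisfying the CAT(0) inequality. The edge-path metric $\rho$ on the vertex set is the least number of edges (one-dimensional cubes) in an edge path joining two vertices. Property A is defined as follows. Let $(V,\rho)$ be a uniformly locally finite discrete metric space (uniformly locally finite: for every $R>0$ the cardinalities of the balls of radius $R$ are uniformly bounded). Then $V$ has Property A if for all $R,\varepsilon>0$ there exists a map $\xi:V\to\ell^1(V)$ such that: $\|\xi(x)\|_1=1$ for all $x\in V$; $\|\xi(x)-\xi(y)\|_1\le\varepsilon$ for all $x,y\in V$ with $\rho(x,y)\le R$; and there exists $S>0$ such that for each $x\in V$, $\xi(x)$ is supported in the closed ball $B(x;S)$ of radius $S$ around $x$. *)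

theory Defs
  imports "HOL-Analysis.Analysis"
begin

section \<open>Euclidean unit cubes\<close>

text \<open>As in \<^const>\<open>Euclidean_space\<close>, points of n-space are functions on the naturals that vanish
  from index n on; in particular the 0-dimensional cube is a single point.\<close>

definition unit_cube :: "nat \<Rightarrow> (nat \<Rightarrow> real) set" where
  "unit_cube n = {x. (\<forall>i<n. 0 \<le> x i \<and> x i \<le> 1) \<and> (\<forall>i\<ge>n. x i = 0)}"

definition cube_topology :: "nat \<Rightarrow> (nat \<Rightarrow> real) topology" where
  "cube_topology n = subtopology (Euclidean_space n) (unit_cube n)"

definition cube_dist :: "nat \<Rightarrow> (nat \<Rightarrow> real) \<Rightarrow> (nat \<Rightarrow> real) \<Rightarrow> real" where
  "cube_dist n x y = L2_set (\<lambda>i. x i - y i) {..<n}"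

text \<open>The (nonempty) faces of a cube, the cube itself included: some coordinates are fixed to be 0,
  some others are fixed to be 1.\<close>

definition cube_face :: "nat \<Rightarrow> (nat \<Rightarrow> real) set \<Rightarrow> bool" where
  "cube_face n F \<longleftrightarrow>
     (\<exists>A B. A \<subseteq> {..<n} \<and> B \<subseteq> {..<n} \<and> A \<inter> B = {} \<and>
            F = {x \<in> unit_cube n. (\<forall>i\<in>A. x i = 0) \<and> (\<forall>i\<in>B. x i = 1)})"

definition cube_isometry ::
    "nat \<Rightarrow> nat \<Rightarrow> (nat \<Rightarrow> real) set \<Rightarrow> ((nat \<Rightarrow> real) \<Rightarrow> (nat \<Rightarrow> real)) \<Rightarrow> bool" where
  "cube_isometry m n F h \<longleftrightarrow>
     h ` unit_cube m = F \<and>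
     (\<forall>x\<in>unit_cube m. \<forall>y\<in>unit_cube m. cube_dist n (h x) (h y) = cube_dist m x y)"


section \<open>Cube complexes\<close>

text \<open>The cells are subsets of the underlying point set; a cell \<open>c\<close> of dimension \<open>cdim c\<close> is
  identified with a Euclidean unit cube by its characteristic map \<open>\<phi> c\<close>. The second axiom says that
  every face of a cell is again a cell, attached by an isometry; the third one says that two cells
  that meet do so in a common face.\<close>

locale cube_complex =
  fixes K :: "'p set set"
    and cdim :: "'p set \<Rightarrow> nat"
    and \<phi> :: "'p set \<Rightarrow> (nat \<Rightarrow> real) \<Rightarrow> 'p"
  assumes char_map: "c \<in> K \<Longrightarrow> bij_betw (\<phi> c) (unit_cube (cdim c)) c"
    and attaching: "\<lbrakk>c \<in> K; cube_face (cdim c) F\<rbrakk> \<Longrightarrow>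
          \<phi> c ` F \<in> K \<and>
          (\<exists>h. cube_isometry (cdim (\<phi> c ` F)) (cdim c) F h \<and>
               (\<forall>x\<in>unit_cube (cdim (\<phi> c ` F)). \<phi> (\<phi> c ` F) x = \<phi> c (h x)))"
    and intersection: "\<lbrakk>c \<in> K; d \<in> K; c \<inter> d \<noteq> {}\<rbrakk> \<Longrightarrow>
          (\<exists>F. cube_face (cdim c) F \<and> c \<inter> d = \<phi> c ` F) \<and>
          (\<exists>G. cube_face (cdim d) G \<and> c \<inter> d = \<phi> d ` G)"

definition finite_dimensional :: "'p set set \<Rightarrow> ('p set \<Rightarrow> nat) \<Rightarrow> bool" where
  "finite_dimensional K cdim \<longleftrightarrow> (\<exists>N. \<forall>c\<in>K. cdim c \<le> N)"

text \<open>The quotient (weak) topology of the disjoint union of the cubes.\<close>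

definition complex_topology ::
    "'p set set \<Rightarrow> ('p set \<Rightarrow> nat) \<Rightarrow> ('p set \<Rightarrow> (nat \<Rightarrow> real) \<Rightarrow> 'p) \<Rightarrow> 'p topology" where
  "complex_topology K cdim \<phi> =
     topology (\<lambda>U. U \<subseteq> \<Union>K \<and>
       (\<forall>c\<in>K. openin (cube_topology (cdim c)) {x \<in> unit_cube (cdim c). \<phi> c x \<in> U}))"

lemma openin_complex_topology:
  "openin (complex_topology K cdim \<phi>) U \<longleftrightarrow>
     U \<subseteq> \<Union>K \<and> (\<forall>c\<in>K. openin (cube_topology (cdim c)) {x \<in> unit_cube (cdim c). \<phi> c x \<in> U})"
proof -
  let ?P = "\<lambda>U. U \<subseteq> \<Union>K \<and>
       (\<forall>c\<in>K. openin (cube_topology (cdim c)) {x \<in> unit_cube (cdim c). \<phi> c x \<in> U})"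
  have "istopology ?P"
    unfolding istopology_def
  proof (intro conjI allI impI)
    fix S T assume S: "?P S" and T: "?P T"
    have "{x \<in> unit_cube (cdim c). \<phi> c x \<in> S \<inter> T} =
          {x \<in> unit_cube (cdim c). \<phi> c x \<in> S} \<inter> {x \<in> unit_cube (cdim c). \<phi> c x \<in> T}" for c
      by blast
    with S T show "S \<inter> T \<subseteq> \<Union>K"
      and "\<forall>c\<in>K. openin (cube_topology (cdim c)) {x \<in> unit_cube (cdim c). \<phi> c x \<in> S \<inter> T}"
      by (auto intro: openin_Int)
  next
    fix \<K> assume *: "\<forall>S\<in>\<K>. ?P S"
    have eq: "{x \<in> unit_cube (cdim c). \<phi> c x \<in> \<Union>\<K>} =
          \<Union>((\<lambda>S. {x \<in> unit_cube (cdim c). \<phi> c x \<in> S}) ` \<K>)" for c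
      by blast
    from * show "\<Union>\<K> \<subseteq> \<Union>K"
      by blast
    from * show "\<forall>c\<in>K. openin (cube_topology (cdim c)) {x \<in> unit_cube (cdim c). \<phi> c x \<in> \<Union>\<K>}"
      unfolding eq by (intro ballI openin_Union) blast
  qed
  then show ?thesis
    by (simp add: complex_topology_def topology_inverse')
qed

text \<open>Path connected, and every loop is null-homotopic relative to its base point. (The library
  notion \<^const>\<open>simply_connected\<close> is only available for type-class topologies.)\<close>

definition simply_connected_space :: "'a topology \<Rightarrow> bool" where
  "simply_connected_space X \<longleftrightarrow>
     path_connected_space X \<and>
     (\<forall>p. pathin X p \<and> p 0 = p 1 \<longrightarrow>
        homotopic_with (\<lambda>q. q 0 = p 0 \<and> q 1 = p 0) (top_of_set {0..1}) X p (\<lambda>_. p 0))"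


section \<open>Gromov's link condition\<close>

definition vertices :: "'p set set \<Rightarrow> ('p set \<Rightarrow> nat) \<Rightarrow> 'p set" where
  "vertices K cdim = {v. {v} \<in> K \<and> cdim {v} = 0}"

definition edges :: "'p set set \<Rightarrow> ('p set \<Rightarrow> nat) \<Rightarrow> 'p set set" where
  "edges K cdim = {e \<in> K. cdim e = 1}"

text \<open>The link of \<open>v\<close> as an abstract complex: its vertices are the edges at \<open>v\<close>, and every cube of
  positive dimension containing \<open>v\<close> contributes the simplex spanned by its edges at \<open>v\<close>.\<close>

definition link :: "'p set set \<Rightarrow> ('p set \<Rightarrow> nat) \<Rightarrow> 'p \<Rightarrow> 'p set set set" where
  "link K cdim v = {{e \<in> edges K cdim. v \<in> e \<and> e \<subseteq> c} | c. c \<in> K \<and> v \<in> c \<and> cdim c \<ge> 1}"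

definition simplicial_cplx :: "'a set set \<Rightarrow> bool" where
  "simplicial_cplx L \<longleftrightarrow>
     (\<forall>\<sigma>\<in>L. finite \<sigma> \<and> \<sigma> \<noteq> {} \<and> (\<forall>\<tau>. \<tau> \<subseteq> \<sigma> \<and> \<tau> \<noteq> {} \<longrightarrow> \<tau> \<in> L))"

text \<open>The case \<open>a = b\<close> below says that the elements of \<open>\<sigma>\<close> are vertices of \<open>L\<close>.\<close>

definition flag_cplx :: "'a set set \<Rightarrow> bool" where
  "flag_cplx L \<longleftrightarrow>
     simplicial_cplx L \<and>
     (\<forall>\<sigma>. finite \<sigma> \<and> \<sigma> \<noteq> {} \<and> (\<forall>a\<in>\<sigma>. \<forall>b\<in>\<sigma>. {a, b} \<in> L) \<longrightarrow> \<sigma> \<in> L)"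

locale CAT0_cube_complex = cube_complex K cdim \<phi>
  for K :: "'p set set"
    and cdim :: "'p set \<Rightarrow> nat"
    and \<phi> :: "'p set \<Rightarrow> (nat \<Rightarrow> real) \<Rightarrow> 'p" +
  assumes simply_connected: "simply_connected_space (complex_topology K cdim \<phi>)"
    and link_condition: "v \<in> vertices K cdim \<Longrightarrow> flag_cplx (link K cdim v)"


section \<open>The edge-path metric\<close>

definition edge_rel :: "'p set set \<Rightarrow> ('p set \<Rightarrow> nat) \<Rightarrow> ('p \<times> 'p) set" where
  "edge_rel K cdim =
     {(v, w). v \<in> vertices K cdim \<and> w \<in> vertices K cdim \<and> v \<noteq> w \<and>
              (\<exists>e\<in>edges K cdim. v \<in> e \<and> w \<in> e)}"

definition edge_path_metric :: "'p set set \<Rightarrow> ('p set \<Rightarrow> nat) \<Rightarrow> 'p \<Rightarrow> 'p \<Rightarrow> real" where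
  "edge_path_metric K cdim v w = real (LEAST n. (v, w) \<in> edge_rel K cdim ^^ n)"


section \<open>Property A\<close>

text \<open>The defining condition makes sense for every metric space, and no local finiteness is built
  in: a finite dimensional CAT(0) cube complex need not be locally finite.\<close>

definition property_A :: "'a set \<Rightarrow> ('a \<Rightarrow> 'a \<Rightarrow> real) \<Rightarrow> bool" where
  "property_A V \<rho> \<longleftrightarrow>
     Metric_space V \<rho> \<and>
     (\<forall>R>0. \<forall>\<epsilon>>0. \<exists>\<xi> :: 'a \<Rightarrow> 'a \<Rightarrow> real.
        (\<forall>x\<in>V. (\<lambda>z. \<bar>\<xi> x z\<bar>) summable_on V \<and> (\<Sum>\<^sub>\<infinity>z\<in>V. \<bar>\<xi> x z\<bar>) = 1) \<and>
        (\<forall>x\<in>V. \<forall>y\<in>V. \<rho> x y \<le> R \<longrightarrow> (\<Sum>\<^sub>\<infinity>z\<in>V. \<bar>\<xi> x z - \<xi> y z\<bar>) \<le> \<epsilon>) \<and>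
        (\<exists>S>0. \<forall>x\<in>V. \<forall>z\<in>V. \<xi> x z \<noteq> 0 \<longrightarrow> \<rho> x z \<le> S))"

end

theory Submission
  imports Defs
begin

text \<open>Fix a base vertex \<open>u\<close>. Reduced edge paths from \<open>u\<close>, up to pushing them across squares, behave like
  normal forms in a trace monoid: by the flag condition, two distinct last edges of one class
  span a square. Appending or cancelling an edge therefore acts on classes of reduced paths, and
  squares act trivially. Simple connectivity, applied through a fine grid on a homotopy and the
  cover by open vertex stars, shows that such an action has no monodromy, so reduced paths are
  unique up to equivalence. This makes the 1-skeleton bipartite and gives the quadrangle condition
  of median graphs for every base vertex.

  For Property A, a vertex \<open>x\<close> spreads mass over the vertices between \<open>u\<close> and \<open>x\<close> at distance at
  most \<open>l\<close>, a vertex \<open>y\<close> with \<open>N - k\<close> lower neighbours receiving the binomial coefficient of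
  \<open>l - d(x, y) + k\<close> over \<open>k\<close>. The quadrangle condition makes the total mass that of an
  \<open>N\<close>-dimensional orthant for every \<open>x\<close>. If \<open>a\<close> is a lower neighbour of \<open>x\<close>, then the mass of \<open>x\<close> with
  parameter \<open>l\<close> restricts to that of \<open>a\<close> with parameter \<open>l - 1\<close>, so the normalised masses of
  adjacent vertices differ by at most \<open>2 N / l\<close>.\<close>

section \<open>Reduced paths in square complexes\<close>

text \<open>The obstacle is that the link condition is local while distances are global. The bridge
  is holonomy: a \<open>local_system\<close> attaches a set to every vertex and mutually inverse
  maps to the two directions of every edge, with trivial holonomy around squares, and simple
  connectivity provides a flat section through every point. Applied to classes of reduced paths,
  this compares all reduced paths from one base vertex, without hyperplanes and without a topology
  on a covering space.

  The binomial coefficients count monomials. If the interval below \<open>x\<close> were an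
  \<open>N\<close>-dimensional orthant with apex \<open>x\<close>, the displacement from
  \<open>x\<close> to \<open>y\<close> would be a monomial of degree d(x, y), and l + N over N
  monomials have degree at most l. Those of degree exactly l form the fraction N / (l + N) of them;
  this is the source of the estimate for adjacent vertices. Finite dimension enters as a bound on
  the number of lower neighbours of a vertex, which may have infinitely many neighbours
  altogether.\<close>

definition local_system ::
    "('v \<times> 'v) set \<Rightarrow> ('v \<Rightarrow> 'v \<Rightarrow> 'v \<Rightarrow> 'v \<Rightarrow> bool) \<Rightarrow> ('v \<Rightarrow> 'f set) \<Rightarrow> ('v \<Rightarrow> 'v \<Rightarrow> 'f \<Rightarrow> 'f) \<Rightarrow> bool" where
  "local_system E sq F act \<longleftrightarrow>
     (\<forall>v w. (v, w) \<in> E \<longrightarrow> (\<forall>f\<in>F v. act v w f \<in> F w \<and> act w v (act v w f) = f)) \<and>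
     (\<forall>x a b c. sq x a b c \<longrightarrow> (\<forall>f\<in>F x. act a c (act x a f) = act b c (act x b f)))"

text \<open>In \<open>sq x a b c\<close> the vertices \<open>a\<close> and \<open>b\<close> are
  neighbours of \<open>x\<close>, and \<open>c\<close> is opposite to \<open>x\<close>. The axiom
  \<open>sq_cube\<close> is the flag condition for triples in a link: three squares around a corner
  complete to a 3-cube with last vertex \<open>g\<close>.\<close>

locale square_graph =
  fixes E :: "('v \<times> 'v) set"
    and sq :: "'v \<Rightarrow> 'v \<Rightarrow> 'v \<Rightarrow> 'v \<Rightarrow> bool"
  assumes sym_E: "(x, y) \<in> E \<Longrightarrow> (y, x) \<in> E"
    and sq_adj: "sq x a b c \<Longrightarrow> (x, a) \<in> E"
    and sq_neq: "sq x a b c \<Longrightarrow> a \<noteq> b"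
    and sq_swap: "sq x a b c \<Longrightarrow> sq x b a c"
    and sq_rot: "sq x a b c \<Longrightarrow> sq a x c b"
    and sq_unique: "\<lbrakk>sq x a b c; sq x a b d\<rbrakk> \<Longrightarrow> c = d"
    and sq_cube: "\<lbrakk>sq x a b p; sq x b c q; sq x a c r\<rbrakk> \<Longrightarrow> \<exists>g. sq a p r g \<and> sq b p q g \<and> sq c r q g"
begin

lemma sq_adj2: "sq x a b c \<Longrightarrow> (a, c) \<in> E"
  by (rule sq_adj[OF sq_swap[OF sq_rot]])

text \<open>A path is the list of its vertices in reverse order: its head is the endpoint.\<close>

inductive swap :: "'v list \<Rightarrow> 'v list \<Rightarrow> bool" where
  square: "sq x a b c \<Longrightarrow> swap (x # a # c # r) (x # b # c # r)"
| Cons: "swap p q \<Longrightarrow> swap (x # p) (x # q)"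

abbreviation path_equiv :: "'v list \<Rightarrow> 'v list \<Rightarrow> bool" (infix \<open>\<simeq>\<close> 50) where
  "p \<simeq> q \<equiv> swap\<^sup>*\<^sup>* p q"

lemma swap_sym: "swap p q \<Longrightarrow> swap q p"
  by (induction rule: swap.induct) (auto intro: swap.intros sq_swap)

lemma equiv_sym: "p \<simeq> q \<Longrightarrow> q \<simeq> p"
  by (metis swap_sym sympD sympI symp_rtranclp)

lemma equiv_trans [trans]: "\<lbrakk>p \<simeq> q; q \<simeq> r\<rbrakk> \<Longrightarrow> p \<simeq> r"
  by (rule rtranclp_trans)

lemma equiv_Cons: "p \<simeq> q \<Longrightarrow> x # p \<simeq> x # q"
  by (induction rule: rtranclp_induct) (auto intro: swap.Cons rtranclp.rtrancl_into_rtrancl)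

lemma equiv_square: "sq x a b c \<Longrightarrow> x # a # c # r \<simeq> x # b # c # r"
  by (simp add: r_into_rtranclp swap.square)

lemma swap_invariants: "swap p q \<Longrightarrow>
    length q = length p \<and> p \<noteq> [] \<and> q \<noteq> [] \<and> hd q = hd p \<and> last q = last p"
  by (induction rule: swap.induct) auto

lemma equiv_invariants:
  assumes "p \<simeq> q"
  shows "length q = length p" "hd q = hd p" "last q = last p" "p \<noteq> [] \<Longrightarrow> q \<noteq> []"
  using assms by (induction rule: rtranclp_induct) (auto dest: swap_invariants)

lemma equiv_Cons_D: "x # p \<simeq> q \<Longrightarrow> \<exists>q'. q = x # q'"
  by (metis equiv_invariants(2,4) list.distinct(1) list.exhaust_sel list.sel(1))

section \<open>How two equivalent paths with the same endpoint can differ\<close>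

definition diamond :: "'v \<Rightarrow> 'v list \<Rightarrow> 'v list \<Rightarrow> bool" where
  "diamond x p q \<longleftrightarrow> p \<simeq> q \<or> (\<exists>a b c r. sq x a b c \<and> p \<simeq> a # c # r \<and> q \<simeq> b # c # r)"

lemma diamond_swap: "swap (x # p) (x # q) \<Longrightarrow> diamond x p q"
  by (erule swap.cases) (auto simp: diamond_def)

text \<open>The two squares share the edge from \<open>x\<close> to \<open>b\<close>. Below
  \<open>b\<close>, the induction hypothesis either identifies them or supplies a third square at
  \<open>b\<close>; in the latter case \<open>sq_cube\<close> at the corner \<open>b\<close>
  produces a square at \<open>x\<close> with opposite vertex \<open>g\<close>.\<close>

lemma diamond_trans:
  assumes IH: "\<And>y p' q'. \<lbrakk>length p' < length p; y # p' \<simeq> y # q'\<rbrakk> \<Longrightarrow> diamond y p' q'"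
    and pq: "diamond x p q" and qs: "diamond x q s"
  shows "diamond x p s"
proof -
  consider "p \<simeq> q" | "q \<simeq> s"
    | a b c r b' d e r2 where "sq x a b c" "p \<simeq> a # c # r" "q \<simeq> b # c # r"
        "sq x b' d e" "q \<simeq> b' # e # r2" "s \<simeq> d # e # r2"
    using pq qs unfolding diamond_def by blast
  then show ?thesis
  proof cases
    case 1
    then show ?thesis using qs unfolding diamond_def by (blast intro: equiv_trans[OF 1])
  next
    case 2
    then show ?thesis using pq unfolding diamond_def
      by (blast intro: equiv_trans[OF equiv_sym[OF 2]] equiv_trans[OF _ 2])
  next
    case 3
    have bb: "b' = b"
      using equiv_invariants(2)[OF 3(3)] equiv_invariants(2)[OF 3(5)] by simp
    have "b # c # r \<simeq> b # e # r2"
      using equiv_trans[OF equiv_sym[OF 3(3)] 3(5)] bb by simp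
    moreover have "length (c # r) < length p"
      using equiv_invariants(1)[OF 3(2)] by simp
    ultimately consider "c # r \<simeq> e # r2"
      | c' e' f r3 where "sq b c' e' f" "c # r \<simeq> c' # f # r3" "e # r2 \<simeq> e' # f # r3"
      using IH unfolding diamond_def by blast
    then show ?thesis
    proof cases
      case 1
      then have "c = e" using equiv_invariants(2) by force
      then have "a = d" using sq_rot[OF sq_swap[OF 3(1)]] sq_rot[OF 3(4)] bb sq_unique by blast
      then have "a # e # r2 \<simeq> s" using equiv_sym[OF 3(6)] by simp
      with equiv_trans[OF 3(2) equiv_Cons[OF 1]] have "p \<simeq> s" by (rule equiv_trans)
      then show ?thesis by (simp add: diamond_def)
    next
      case c: 2
      have "c' = c" "e' = e"
        using equiv_invariants(2)[OF c(2)] equiv_invariants(2)[OF c(3)] by auto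
      note c = c[unfolded this]
      have "sq b x c a" "sq b x e d"
        using sq_rot[OF sq_swap[OF 3(1)]] sq_rot[OF 3(4)] bb by auto
      then obtain g where g: "sq x a d g" "sq c a f g" "sq e d f g"
        using sq_cube c(1) by blast
      have "p \<simeq> a # c # f # r3" using equiv_trans[OF 3(2) equiv_Cons[OF c(2)]] .
      also have "\<dots> \<simeq> a # g # f # r3" using sq_rot[OF g(2)] by (rule equiv_square)
      finally have p: "p \<simeq> a # g # f # r3" .
      have "s \<simeq> d # e # f # r3" using equiv_trans[OF 3(6) equiv_Cons[OF c(3)]] .
      also have "\<dots> \<simeq> d # g # f # r3" using sq_rot[OF g(3)] by (rule equiv_square)
      finally have "s \<simeq> d # g # f # r3" .
      with p g(1) show ?thesis unfolding diamond_def by blast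
    qed
  qed
qed

text \<open>The induction on the length feeds \<open>diamond_trans\<close>; the inner one follows
  the chain of swaps.\<close>

lemma equiv_diamond: "x # p \<simeq> x # q \<Longrightarrow> diamond x p q"
proof (induction "length p" arbitrary: x p q rule: less_induct)
  case less
  have "z = x # s \<Longrightarrow> diamond x p s" if "x # p \<simeq> z" for z s
    using that
  proof (induction arbitrary: s rule: rtranclp_induct)
    case base
    then show ?case by (simp add: diamond_def)
  next
    case (step y z)
    obtain t where "y = x # t" using step(1) equiv_Cons_D by blast
    with step have "diamond x p t" "diamond x t s" using diamond_swap by auto
    then show ?case using less.hyps by (rule diamond_trans[rotated])
  qed
  with less show ?case by blast
qed

text \<open>Equal second vertices exclude the square alternative of \<open>diamond\<close>, because
  the two neighbours of \<open>x\<close> in a square are distinct.\<close>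

lemma equiv_ConsD: "x # a # p \<simeq> x # a # q \<Longrightarrow> a # p \<simeq> a # q"
  using equiv_diamond[of x "a # p" "a # q"] equiv_invariants(2) sq_neq
  unfolding diamond_def by (metis list.sel(1))

lemma equiv_ConsD_square:
  assumes "x # a # p \<simeq> x # b # q" "a \<noteq> b"
  obtains c r where "sq x a b c" "a # p \<simeq> a # c # r" "b # q \<simeq> b # c # r"
  using equiv_diamond[OF assms(1)] assms(2) equiv_invariants(2)
  unfolding diamond_def by (metis list.sel(1))

section \<open>Reduced paths\<close>

fun backtracks :: "'v list \<Rightarrow> bool" where
  "backtracks (x # a # y # r) \<longleftrightarrow> x = y \<or> backtracks (a # y # r)"
| "backtracks _ \<longleftrightarrow> False"

text \<open>A list without a backtrack can acquire one by a swap, as a walk along three sides of a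
  square shows, so the whole class is inspected.\<close>

definition reduced :: "'v list \<Rightarrow> bool" where
  "reduced p \<longleftrightarrow> (\<forall>q. p \<simeq> q \<longrightarrow> \<not> backtracks q)"

lemma backtracks_Cons: "backtracks p \<Longrightarrow> backtracks (x # p)"
  by (induction p rule: backtracks.induct) auto

lemma reduced_equiv: "\<lbrakk>reduced p; p \<simeq> q\<rbrakk> \<Longrightarrow> reduced q"
  unfolding reduced_def by (meson equiv_trans)

lemma reduced_ConsD: "reduced (x # p) \<Longrightarrow> reduced p"
  unfolding reduced_def using backtracks_Cons equiv_Cons by blast

lemma reduced_no_cancel: "reduced (x # w # p) \<Longrightarrow> \<not> w # p \<simeq> w # x # q"
  unfolding reduced_def using equiv_Cons by (metis backtracks.simps(1))

text \<open>By \<open>equiv_diamond\<close>, a backtracking member of the class of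
  \<open>w # x # p\<close> either prolongs a member of the class of \<open>x # p\<close> or comes
  from a square \<open>sq w x b c\<close>. Pushing the backtrack across that square produces, in the
  class of \<open>x # p\<close>, a backtrack or a path whose last edge goes from \<open>w\<close> to
  \<open>x\<close>. Both are excluded.\<close>

lemma reduced_Cons:
  "\<lbrakk>reduced (x # p); \<And>q. \<not> x # p \<simeq> x # w # q\<rbrakk> \<Longrightarrow> reduced (w # x # p)"
proof (induction "length p" arbitrary: x p w rule: less_induct)
  case less
  show ?case
    unfolding reduced_def
  proof (intro allI impI notI)
    fix z assume z: "w # x # p \<simeq> z" "backtracks z"
    obtain q where q: "z = w # q" using equiv_Cons_D z(1) by blast
    consider "x # p \<simeq> q"
      | x' b c r where "sq w x' b c" "x # p \<simeq> x' # c # r" "q \<simeq> b # c # r"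
      using equiv_diamond z(1) q unfolding diamond_def by blast
    then show False
    proof cases
      case 1
      then obtain q' where q': "q = x # q'" using equiv_Cons_D by blast
      from z(2) q q' consider "backtracks q" | q'' where "q' = w # q''"
        by (cases q') auto
      then show False
        using 1 less.prems q' unfolding reduced_def by cases auto
    next
      case c: 2
      have "x' = x" using equiv_invariants(2)[OF c(2)] by simp
      note c = c[unfolded this]
      obtain q' where q': "q = b # q'" using equiv_sym[OF c(3)] equiv_Cons_D by blast
      from z(2) q q' consider "backtracks q" | q'' where "q' = w # q''"
        by (cases q') auto
      then show False
      proof cases
        case 1
        then have "\<not> reduced (b # c # r)"
          using c(3) unfolding reduced_def using equiv_sym by blast
        moreover have "reduced (c # r)" using reduced_ConsD[OF reduced_equiv[OF less.prems(1) c(2)]] .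
        moreover have "length r < length p" using equiv_invariants(1)[OF c(2)] by simp
        \<comment> \<open>\<open>c # r\<close> is reduced and shorter, so prolonging it by
          \<open>b\<close> can destroy reducedness only if \<open>b\<close> cancels against its
          end.\<close>
        ultimately obtain r' where "c # r \<simeq> c # b # r'" using less.hyps by blast
        then have "x # p \<simeq> x # c # b # r'" using equiv_trans[OF c(2) equiv_Cons] by blast
        also have "\<dots> \<simeq> x # w # b # r'" using sq_swap[OF sq_rot[OF c(1)]] by (rule equiv_square)
        finally show False using less.prems(2) by blast
      next
        case 2
        have "c \<noteq> w" using c(1) sq_rot sq_neq by blast
        with c(3) q' 2 obtain f r3 where f: "sq b w c f" "c # r \<simeq> c # f # r3"
          by (metis equiv_ConsD_square)
        have "f = x" using f(1) sq_rot[OF sq_swap[OF c(1)]] by (rule sq_unique)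
        then have "x # p \<simeq> x # c # x # r3"
          using equiv_trans[OF c(2) equiv_Cons[OF f(2)]] by simp
        then show False using less.prems(1) unfolding reduced_def by auto
      qed
    qed
  qed
qed

text \<open>The classes of reduced paths form the fibres of the universal cover. Moving along an edge
  cancels it against the end of the path if possible and appends it otherwise.\<close>

definition path_class :: "'v list \<Rightarrow> 'v list set" where
  "path_class p = {q. p \<simeq> q}"

definition fibre :: "'v \<Rightarrow> 'v list set set" where
  "fibre v = {path_class (v # p) | p. reduced (v # p)}"

definition move :: "'v \<Rightarrow> 'v \<Rightarrow> 'v list set \<Rightarrow> 'v list set" where
  "move v w P = (if \<exists>q. v # w # q \<in> P then path_class (w # (SOME q. v # w # q \<in> P))
                 else path_class (w # (SOME p. p \<in> P)))"

lemma path_class_eq_iff: "path_class p = path_class q \<longleftrightarrow> p \<simeq> q"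
  unfolding path_class_def using equiv_trans equiv_sym by blast

text \<open>The choice made by \<open>SOME\<close> in \<open>move\<close> is harmless: by
  \<open>equiv_ConsD\<close> all admissible tails give the same class.\<close>

lemma move_cancel: "move v w (path_class (v # w # q)) = path_class (w # q)"
proof -
  let ?P = "\<lambda>r. v # w # r \<in> path_class (v # w # q)"
  have ex: "?P q" by (simp add: path_class_def)
  then have "?P (SOME r. ?P r)" by (rule someI)
  then have "w # q \<simeq> w # (SOME r. ?P r)" unfolding path_class_def using equiv_ConsD by simp
  then have "path_class (w # (SOME r. ?P r)) = path_class (w # q)"
    unfolding path_class_eq_iff by (rule equiv_sym)
  moreover have "\<exists>r. ?P r" using ex by blast
  ultimately show ?thesis unfolding move_def by simp
qed

lemma move_append:
  assumes "\<And>q. \<not> p \<simeq> v # w # q"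
  shows "move v w (path_class p) = path_class (w # p)"
proof -
  have "p \<simeq> (SOME q. q \<in> path_class p)"
    using someI[of "\<lambda>q. q \<in> path_class p" p] by (simp add: path_class_def)
  then have "path_class (w # (SOME q. q \<in> path_class p)) = path_class (w # p)"
    using path_class_eq_iff equiv_Cons equiv_sym by blast
  then show ?thesis using assms by (simp add: move_def path_class_def)
qed

lemma move_back:
  assumes "P \<in> fibre v"
  shows "move v w P \<in> fibre w \<and> move w v (move v w P) = P"
proof -
  obtain p where p: "P = path_class (v # p)" "reduced (v # p)"
    using assms unfolding fibre_def by blast
  show ?thesis
  proof (cases "\<exists>q. v # p \<simeq> v # w # q")
    case True
    then obtain q where q: "v # p \<simeq> v # w # q" by blast
    then have P: "P = path_class (v # w # q)" and r: "reduced (v # w # q)"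
      using p(1) reduced_equiv[OF p(2) q] by (simp_all add: path_class_eq_iff)
    have "move w v (path_class (w # q)) = path_class (v # w # q)"
      using reduced_no_cancel r by (intro move_append) blast
    then show ?thesis
      using r reduced_ConsD unfolding P move_cancel fibre_def by blast
  next
    case False
    then have "move v w P = path_class (w # v # p)" using p move_append by blast
    moreover have "reduced (w # v # p)" using reduced_Cons p False by blast
    ultimately show ?thesis using p move_cancel unfolding fibre_def by auto
  qed
qed

text \<open>Suppose that the class ends with the edge from \<open>a\<close> to \<open>x\<close>. If
  \<open>c\<close> comes before \<open>a\<close> in some representative, one swap shows that both
  routes cancel twice. Otherwise the route through \<open>a\<close> cancels and then appends, while
  the route through \<open>b\<close> appends and then cancels after a swap. If neither edge at
  \<open>x\<close> cancels, both routes append twice and their results differ by one swap.\<close>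

lemma move_square:
  assumes sq: "sq x a b c" and "P \<in> fibre x"
  shows "move a c (move x a P) = move b c (move x b P)"
proof -
  obtain p where p: "P = path_class (x # p)" "reduced (x # p)"
    using assms unfolding fibre_def by blast
  have cancel1: "move a c (move x a P) = move b c (move x b P)"
    if sq: "sq x a b c" and q: "x # p \<simeq> x # a # q" for a b q
  proof (cases "\<exists>r. a # q \<simeq> a # c # r")
    case True
    then obtain r where r: "a # q \<simeq> a # c # r" by blast
    then have 1: "x # p \<simeq> x # a # c # r" using equiv_trans[OF q equiv_Cons] by blast
    also have "\<dots> \<simeq> x # b # c # r" using sq by (rule equiv_square)
    finally have 2: "x # p \<simeq> x # b # c # r" .
    show ?thesis using 1 2 p(1) by (metis path_class_eq_iff move_cancel)
  next
    case False
    have no: "\<not> x # a # q \<simeq> x # b # r" for r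
    proof
      assume "x # a # q \<simeq> x # b # r"
      then obtain c' r' where "sq x a b c'" "a # q \<simeq> a # c' # r'"
        using equiv_ConsD_square sq sq_neq by metis
      with sq False sq_unique show False by blast
    qed
    have "move x a P = path_class (a # q)"
      using p(1) q path_class_eq_iff move_cancel by metis
    then have "move a c (move x a P) = path_class (c # a # q)"
      using False move_append by metis
    moreover have "move x b P = path_class (b # x # a # q)"
      using p(1) q path_class_eq_iff move_append no by metis
    moreover have "b # x # a # q \<simeq> b # c # a # q"
      using sq_rot[OF sq_swap[OF sq]] by (rule equiv_square)
    ultimately show ?thesis by (metis path_class_eq_iff move_cancel)
  qed
  consider q where "x # p \<simeq> x # a # q" | q where "x # p \<simeq> x # b # q"
    | "\<And>q. \<not> x # p \<simeq> x # a # q" "\<And>q. \<not> x # p \<simeq> x # b # q" by blast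
  then show ?thesis
  proof cases
    case 1
    then show ?thesis using cancel1 sq by blast
  next
    case 2
    then show ?thesis using cancel1[of b a] sq sq_swap by metis
  next
    case 3
    have app: "move a c (move x a P) = path_class (c # a # x # p)"
      if sq: "sq x a b c" and na: "\<And>q. \<not> x # p \<simeq> x # a # q" and nb: "\<And>q. \<not> x # p \<simeq> x # b # q" for a b
    proof -
      have "\<not> a # x # p \<simeq> a # c # r" for r
      proof
        assume "a # x # p \<simeq> a # c # r"
        moreover have "x \<noteq> c" using sq sq_rot sq_neq by blast
        ultimately obtain b' r' where "sq a x c b'" "x # p \<simeq> x # b' # r'"
          using equiv_ConsD_square by metis
        moreover have "sq a x c b" using sq by (rule sq_rot)
        ultimately show False using nb sq_unique by blast
      qed
      then show ?thesis using p na move_append by metis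
    qed
    have "c # a # x # p \<simeq> c # b # x # p"
      using sq_rot[OF sq_swap[OF sq_rot[OF sq]]] by (rule equiv_square)
    then show ?thesis
      using app[OF sq 3] app[OF sq_swap[OF sq] 3(2,1)] by (simp add: path_class_eq_iff)
  qed
qed

lemma local_system_move: "local_system E sq fibre move"
  unfolding local_system_def using move_back move_square by auto

text \<open>\<open>reduced\<close> and \<open>fibre\<close> range over all lists of vertices.
  Adjacency enters here, where lengths are compared with distances and flat sections are followed
  along edges.\<close>

fun is_path :: "'v list \<Rightarrow> bool" where
  "is_path (v # w # r) \<longleftrightarrow> (v, w) \<in> E \<and> is_path (w # r)"
| "is_path [v] \<longleftrightarrow> True"
| "is_path [] \<longleftrightarrow> False"

lemma is_path_swap: "swap p q \<Longrightarrow> is_path p \<Longrightarrow> is_path q"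
proof (induction rule: swap.induct)
  case (square x a b c r)
  then show ?case
    using sq_adj[OF sq_swap[OF square(1)]] sq_adj2[OF sq_swap[OF square(1)]] by simp
next
  case (Cons p q x)
  obtain u p' q' where "p = u # p'" "q = u # q'"
    using swap_invariants[OF Cons(1)] by (metis list.exhaust_sel)
  with Cons show ?case by auto
qed

lemma is_path_equiv: "\<lbrakk>p \<simeq> q; is_path p\<rbrakk> \<Longrightarrow> is_path q"
  by (induction rule: rtranclp_induct) (auto intro: is_path_swap)

lemma is_path_relpow: "is_path p \<Longrightarrow> (last p, hd p) \<in> E ^^ (length p - 1)"
  by (induction p rule: is_path.induct) (auto dest: sym_E intro: relpow_Suc_I)

lemma relpow_is_path: "(u, v) \<in> E ^^ n \<Longrightarrow> \<exists>p. is_path (v # p) \<and> last (v # p) = u \<and> length p = n"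
proof (induction n arbitrary: v)
  case 0
  then show ?case by (intro exI[of _ "[]"]) auto
next
  case (Suc n)
  then obtain w where w: "(u, w) \<in> E ^^ n" "(w, v) \<in> E" by auto
  with Suc obtain p where "is_path (w # p)" "last (w # p) = u" "length p = n" by blast
  with w show ?case by (intro exI[of _ "w # p"]) (auto intro: sym_E)
qed

lemma backtracks_shorten:
  "\<lbrakk>is_path p; backtracks p\<rbrakk> \<Longrightarrow>
     \<exists>q. is_path q \<and> hd q = hd p \<and> last q = last p \<and> length q + 2 = length p"
proof (induction p rule: backtracks.induct)
  case (1 x a y r)
  show ?case
  proof (cases "x = y")
    case True
    with 1 show ?thesis by (intro exI[of _ "y # r"]) auto
  next
    case False
    with 1 obtain q where q: "is_path q" "hd q = a" "last q = last (a # y # r)"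
        "length q + 2 = length (a # y # r)" by auto
    then have "q \<noteq> []" by auto
    with q 1(2) show ?thesis by (intro exI[of _ "x # q"]) (cases q; auto)
  qed
qed auto

end

section \<open>Distances in a simply connected square complex\<close>

definition graph_dist :: "('v \<times> 'v) set \<Rightarrow> 'v \<Rightarrow> 'v \<Rightarrow> nat" where
  "graph_dist E u v = (LEAST n. (u, v) \<in> E ^^ n)"

text \<open>\<open>section_exists\<close> is simple connectivity in the form of vanishing monodromy.
  A locale assumption cannot quantify over types, so the fibres have the type of path classes, which
  is the instance that \<open>reduced_unique\<close> takes.\<close>

locale simply_connected_square_graph = square_graph E sq
  for E :: "('v \<times> 'v) set" and sq +
  fixes V :: "'v set"
  assumes E_subset: "E \<subseteq> V \<times> V"
    and connected: "\<lbrakk>u \<in> V; v \<in> V\<rbrakk> \<Longrightarrow> (u, v) \<in> E\<^sup>*"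
    and section_exists: "\<lbrakk>local_system E sq F act; u \<in> V; f \<in> F u\<rbrakk> \<Longrightarrow>
          \<exists>s :: 'v \<Rightarrow> 'v list set. s u = f \<and> (\<forall>(v, w)\<in>E. act v w (s v) = s w)"
begin

abbreviation gd :: "'v \<Rightarrow> 'v \<Rightarrow> nat" where
  "gd \<equiv> graph_dist E"

lemma gd_le: "(u, v) \<in> E ^^ n \<Longrightarrow> gd u v \<le> n"
  unfolding graph_dist_def by (rule Least_le)

lemma gd_relpow: "\<lbrakk>u \<in> V; v \<in> V\<rbrakk> \<Longrightarrow> (u, v) \<in> E ^^ gd u v"
  unfolding graph_dist_def using connected[of u v] by (metis LeastI_ex rtrancl_imp_relpow)

lemma gd_triangle: "\<lbrakk>u \<in> V; v \<in> V; w \<in> V\<rbrakk> \<Longrightarrow> gd u w \<le> gd u v + gd v w"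
  by (intro gd_le) (auto simp: relpow_add intro: gd_relpow)

lemma relpow_sym: "(u, v) \<in> E ^^ n \<Longrightarrow> (v, u) \<in> E ^^ n"
proof (induction n arbitrary: v)
  case (Suc n)
  then obtain w where "(u, w) \<in> E ^^ n" "(w, v) \<in> E" by auto
  then show ?case using relpow_Suc_I2[OF sym_E] Suc.IH by blast
qed auto

lemma gd_sym: "gd u v = gd v u"
  unfolding graph_dist_def using relpow_sym by metis

lemma gd_eq_0: "\<lbrakk>u \<in> V; v \<in> V\<rbrakk> \<Longrightarrow> gd u v = 0 \<longleftrightarrow> u = v"
  using gd_relpow[of u v] gd_le[of u v 0] by auto

lemma gd_step: "\<lbrakk>u \<in> V; (v, w) \<in> E\<rbrakk> \<Longrightarrow> gd u w \<le> Suc (gd u v)"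
  using E_subset gd_relpow[of u v] by (intro gd_le) auto

lemma gd_path_le: "is_path p \<Longrightarrow> gd (last p) (hd p) \<le> length p - 1"
  by (intro gd_le is_path_relpow)

lemma geodesic_exists:
  assumes "u \<in> V" "v \<in> V"
  obtains p where "is_path (v # p)" "last (v # p) = u" "length p = gd u v"
  using relpow_is_path[OF gd_relpow[OF assms]] by blast

text \<open>Swaps preserve length and endpoints, so a backtrack anywhere in the class would yield a
  path shorter than the distance.\<close>

lemma geodesic_reduced:
  assumes "is_path p" "length p = Suc (gd (last p) (hd p))"
  shows "reduced p"
  unfolding reduced_def
proof (intro allI impI notI)
  fix q assume q: "p \<simeq> q" "backtracks q"
  then obtain q' where "is_path q'" "hd q' = hd p" "last q' = last p" "length q' + 2 = length p"
    using backtracks_shorten[OF is_path_equiv[OF q(1) assms(1)] q(2)] equiv_invariants[OF q(1)] by auto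
  with gd_path_le[of q'] assms(2) show False by simp
qed

text \<open>A flat section that starts with the trivial class at \<open>u\<close> is forced along
  every reduced path: each step appends, so the value at the endpoint is the class of the path
  itself. Two reduced paths with common ends therefore have the same class.\<close>

lemma reduced_unique:
  assumes p: "is_path p" "reduced p" and q: "is_path q" "reduced q"
    and "hd p = hd q" "last p = last q" "last p \<in> V"
  shows "p \<simeq> q"
proof -
  define u where "u = last p"
  have "reduced [u]"
    unfolding reduced_def using equiv_invariants(1)[of "[u]"]
    by (metis backtracks.simps(2,3) length_0_conv length_Cons length_Suc_conv)
  then have "path_class [u] \<in> fibre u" unfolding fibre_def by blast
  then have "\<exists>s. s u = path_class [u] \<and> (\<forall>(v, w)\<in>E. move v w (s v) = s w)"
    using assms(7) u_def by (intro section_exists[OF local_system_move]) auto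
  then obtain s where s: "s u = path_class [u]" "\<forall>(v, w)\<in>E. move v w (s v) = s w"
    by (elim exE conjE)
  have s_hd: "s (hd p) = path_class p" if "is_path p" "reduced p" "last p = u" for p
    using that
  proof (induction p rule: is_path.induct)
    case (1 v w r)
    then have "s w = path_class (w # r)" using reduced_ConsD by auto
    moreover have "move w v (path_class (w # r)) = path_class (v # w # r)"
      using reduced_no_cancel[OF 1(3)] by (intro move_append) blast
    moreover have "move w v (s w) = s v" using s(2) 1(2) sym_E by auto
    ultimately show ?case by simp
  qed (use s in auto)
  have "path_class p = path_class q" using s_hd[of p] s_hd[of q] assms u_def by simp
  then show ?thesis by (simp add: path_class_eq_iff)
qed

text \<open>Either the class of a geodesic to \<open>x\<close> ends with the edge from
  \<open>w\<close>, or the geodesic extends to a reduced path to \<open>w\<close>, which by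
  uniqueness is as long as a geodesic.\<close>

lemma gd_adjacent:
  assumes "u \<in> V" "(x, w) \<in> E"
  shows "gd u w = Suc (gd u x) \<or> gd u x = Suc (gd u w)"
proof -
  have xw: "x \<in> V" "w \<in> V" using assms E_subset by auto
  obtain p where p: "is_path (x # p)" "last (x # p) = u" "length p = gd u x"
    using geodesic_exists assms(1) xw(1) by blast
  obtain q where q: "is_path (w # q)" "last (w # q) = u" "length q = gd u w"
    using geodesic_exists assms(1) xw(2) by blast
  have rp: "reduced (x # p)" and rq: "reduced (w # q)" using p q by (auto intro: geodesic_reduced)
  show ?thesis
  proof (cases "\<exists>r. x # p \<simeq> x # w # r")
    case True
    then obtain r where r: "x # p \<simeq> x # w # r" by blast
    have "is_path (w # r)" using is_path_equiv[OF r p(1)] by simp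
    then have "gd u w \<le> length r" using gd_path_le[of "w # r"] equiv_invariants(3)[OF r] p(2) by simp
    moreover have "length p = Suc (length r)" using equiv_invariants(1)[OF r] by simp
    ultimately show ?thesis using p(3) gd_step[OF assms(1) sym_E[OF assms(2)]] by simp
  next
    case False
    then have "reduced (w # x # p)" using reduced_Cons rp by blast
    moreover have "is_path (w # x # p)" using p assms(2) sym_E by simp
    ultimately have "w # x # p \<simeq> w # q"
      using rq q p assms(1) by (intro reduced_unique) auto
    then show ?thesis using equiv_invariants(1) p(3) q(3) by fastforce
  qed
qed

text \<open>Geodesics to \<open>x\<close> through \<open>a\<close> and through \<open>b\<close> are
  equivalent by uniqueness, and \<open>equiv_ConsD_square\<close> extracts the square from the
  equivalence.\<close>

lemma quadrangle:
  assumes u: "u \<in> V" and xa: "(x, a) \<in> E" "gd u x = Suc (gd u a)"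
    and xb: "(x, b) \<in> E" "gd u x = Suc (gd u b)" and "a \<noteq> b"
  obtains c where "sq x a b c" "gd u a = Suc (gd u c)"
proof -
  have V: "x \<in> V" "a \<in> V" "b \<in> V" using xa(1) xb(1) E_subset by auto
  obtain p where p: "is_path (a # p)" "last (a # p) = u" "length p = gd u a"
    using geodesic_exists u V by blast
  obtain q where q: "is_path (b # q)" "last (b # q) = u" "length q = gd u b"
    using geodesic_exists u V by blast
  have "reduced (x # a # p)" using p xa by (intro geodesic_reduced) auto
  moreover have "reduced (x # b # q)" using q xb by (intro geodesic_reduced) auto
  ultimately have "x # a # p \<simeq> x # b # q"
    using p q xa(1) xb(1) u by (intro reduced_unique) auto
  then obtain c r where c: "sq x a b c" "a # p \<simeq> a # c # r"
    using equiv_ConsD_square \<open>a \<noteq> b\<close> by metis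
  have "is_path (c # r)" using is_path_equiv[OF c(2) p(1)] by simp
  then have "gd u c \<le> length r" using gd_path_le[of "c # r"] equiv_invariants(3)[OF c(2)] p(2) by simp
  moreover have "length p = Suc (length r)" using equiv_invariants(1)[OF c(2)] by simp
  moreover have "gd u a = Suc (gd u c) \<or> gd u c = Suc (gd u a)"
    using gd_adjacent[OF u sq_adj2[OF c(1)]] by blast
  ultimately show ?thesis using that c(1) p(3) by simp
qed

end


section \<open>Property A from the quadrangle condition\<close>

text \<open>The number of monomials of degree at most \<open>l\<close> in \<open>k\<close> variables.\<close>

definition mass :: "nat \<Rightarrow> int \<Rightarrow> real" where
  "mass k l = (if l < 0 then 0 else real ((nat l + k) choose k))"

text \<open>Pascal's rule: split the monomials by whether the additional variable divides them. The
  value 0 for negative \<open>l\<close> makes this correct at \<open>l = 0\<close>.\<close>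

lemma mass_Suc: "mass (Suc k) l = mass (Suc k) (l - 1) + mass k l"
proof -
  consider "l < 0" | "l = 0" | m where "l = int (Suc m)"
    by (metis int_cases negative_zless of_nat_0 not0_implies_Suc)
  then show ?thesis
  proof cases
    case 3
    then have "nat l = Suc m" "nat (l - 1) = m" by auto
    with 3 show ?thesis by (simp add: mass_def)
  qed (auto simp: mass_def)
qed

lemma mass_nonneg: "0 \<le> mass k l"
  by (simp add: mass_def)

lemma mass_mono: "mass k (l - 1) \<le> mass k l"
  by (cases k) (simp_all add: mass_Suc[of _ l] mass_nonneg, simp add: mass_def)

text \<open>The difference counts the monomials of degree exactly \<open>l\<close>, which are the
  fraction \<open>k / (l + k)\<close> of all those counted by \<open>mass k l\<close>.\<close>

lemma mass_difference:
  assumes "l > 0"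
  shows "mass k l - mass k (l - 1) \<le> k / l * mass k l"
proof -
  obtain m where m: "l = int (Suc m)" using assms by (metis gr0_conv_Suc pos_int_cases)
  then have "nat l = Suc m" "nat (l - 1) = m" by auto
  moreover have "(m + k choose k) * (Suc m + k) = (Suc m + k choose k) * Suc m"
    using Suc_times_binomial_eq[of "m + k" m] binomial_symmetric[of k "m + k"]
      binomial_symmetric[of k "Suc m + k"] by (simp add: algebra_simps)
  then have "real (m + k choose k) * (Suc m + k) = (Suc m + k choose k) * Suc m"
    by (metis of_nat_mult)
  then have "real (Suc m + k choose k) * (1 + m) - real (m + k choose k) * (1 + m)
        = real (m + k choose k) * k"
    by (simp add: algebra_simps)
  moreover have "real (m + k choose k) * k \<le> real (Suc m + k choose k) * k"
    by (intro mult_right_mono) (auto intro: binomial_right_mono)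
  ultimately show ?thesis using m by (simp add: mass_def field_simps)
qed

text \<open>\<open>dimension_bound\<close> speaks of pairwise squares because this is what
  \<open>quadrangle\<close> gives for lower neighbours; in a cube complex the flag condition turns
  such a family into edges of one cell.\<close>

locale median_graph_of_bounded_dimension = simply_connected_square_graph +
  fixes N :: nat
  assumes dimension_bound: "\<lbrakk>finite S; \<forall>a\<in>S. (x, a) \<in> E; \<forall>a\<in>S. \<forall>b\<in>S. a \<noteq> b \<longrightarrow> (\<exists>c. sq x a b c)\<rbrakk>
            \<Longrightarrow> card S \<le> N"
begin

context
  fixes u assumes u: "u \<in> V"
begin

definition lower :: "'a \<Rightarrow> 'a set" where
  "lower x = {a. (x, a) \<in> E \<and> gd u x = Suc (gd u a)}"

definition interval :: "'a \<Rightarrow> 'a set" where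
  "interval x = {y \<in> V. gd u y + gd y x = gd u x}"

lemma lower_V: "a \<in> lower x \<Longrightarrow> a \<in> V \<and> x \<in> V"
  using E_subset by (auto simp: lower_def)

lemma lower_square:
  assumes "a \<in> lower x" "b \<in> lower x" "a \<noteq> b"
  obtains c where "sq x a b c" "c \<in> lower a"
proof -
  obtain c where "sq x a b c" "gd u a = Suc (gd u c)"
    using assms quadrangle[OF u, of x a b] unfolding lower_def by blast
  with that show ?thesis using sq_adj2 by (auto simp: lower_def)
qed

text \<open>Lower neighbours pairwise span squares, so the bound holds for each finite set of them
  and hence for the whole set.\<close>

lemma finite_lower: "finite (lower x)" and card_lower: "card (lower x) \<le> N"
proof -
  have "card S \<le> N" if "S \<subseteq> lower x" "finite S" for S
  proof (rule dimension_bound[of S x])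
    show "\<forall>a\<in>S. \<forall>b\<in>S. a \<noteq> b \<longrightarrow> (\<exists>c. sq x a b c)"
      using that lower_square by (metis subsetD)
  qed (use that in \<open>auto simp: lower_def\<close>)
  then show "finite (lower x)" "card (lower x) \<le> N"
    using finite_if_finite_subsets_card_bdd[of "lower x" N] by blast+
qed

lemma interval_lower_dist:
  assumes "a \<in> lower x" "y \<in> interval a"
  shows "gd y x = Suc (gd y a)"
proof -
  have V: "a \<in> V" "x \<in> V" "y \<in> V" using assms lower_V by (auto simp: interval_def)
  have "gd u x \<le> gd u y + gd y x" using gd_triangle u V by blast
  moreover have "gd y x \<le> Suc (gd y a)"
    using gd_step[OF V(3), of a x] assms(1) sym_E by (auto simp: lower_def)
  ultimately show ?thesis using assms by (auto simp: lower_def interval_def)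
qed

lemma interval_lower_subset:
  assumes "a \<in> lower x"
  shows "interval a \<subseteq> interval x"
proof
  fix y assume "y \<in> interval a"
  with assms interval_lower_dist[OF assms this] show "y \<in> interval x"
    by (simp add: lower_def interval_def)
qed

lemma interval_self: "x \<in> V \<Longrightarrow> x \<in> interval x"
  using gd_eq_0[of x x] by (simp add: interval_def)

text \<open>For \<open>y\<close> other than \<open>x\<close>, the vertex before \<open>x\<close> on
  a geodesic from \<open>y\<close> is a lower neighbour of \<open>x\<close> whose interval contains
  \<open>y\<close>.\<close>

lemma interval_eq:
  assumes "x \<in> V"
  shows "interval x = insert x (\<Union>(interval ` lower x))"
proof (intro equalityI subsetI)
  fix y assume y: "y \<in> interval x"
  show "y \<in> insert x (\<Union>(interval ` lower x))"
  proof (cases "y = x")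
    case False
    have yV: "y \<in> V" using y by (simp add: interval_def)
    obtain m where m: "gd y x = Suc m"
      using False gd_eq_0[OF yV assms] not0_implies_Suc by blast
    then obtain a where a: "(y, a) \<in> E ^^ m" "(a, x) \<in> E"
      using gd_relpow[OF yV assms] by auto
    then have "a \<in> V" using E_subset by auto
    have "gd y a \<le> m" using a(1) by (rule gd_le)
    moreover have "gd u a \<le> gd u y + gd y a" using gd_triangle u yV \<open>a \<in> V\<close> by blast
    moreover have "gd u x \<le> Suc (gd u a)" using gd_step u a(2) by blast
    ultimately have "gd u x = Suc (gd u a)" "gd u y + gd y a = gd u a"
      using y m by (auto simp: interval_def)
    then show ?thesis using a(2) yV by (auto simp: lower_def interval_def intro: sym_E)
  qed simp
qed (use assms interval_self interval_lower_subset in blast)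

lemma not_in_interval_lower: "a \<in> lower x \<Longrightarrow> x \<notin> interval a"
  by (auto simp: lower_def interval_def)

lemma finite_interval: "x \<in> V \<Longrightarrow> finite (interval x)"
proof (induction "gd u x" arbitrary: x rule: less_induct)
  case less
  then have "finite (interval a)" if "a \<in> lower x" for a
    using that lower_V[OF that] by (auto simp: lower_def)
  then show ?case using less.prems finite_lower by (simp add: interval_eq)
qed

text \<open>The quadrangle condition is used with base \<open>y\<close> instead of \<open>u\<close>:
  both \<open>a\<close> and \<open>b\<close> are closer to \<open>y\<close> than \<open>x\<close>
  is, so a square at \<open>x\<close> has an opposite vertex still closer to \<open>y\<close>, and
  \<open>sq_unique\<close> identifies it with \<open>c\<close>.\<close>

lemma interval_inter:
  assumes "a \<in> lower x" "b \<in> lower x" "sq x a b c" "c \<in> lower a"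
  shows "interval a \<inter> interval b = interval c"
proof (intro equalityI subsetI)
  fix y assume y: "y \<in> interval a \<inter> interval b"
  then have yV: "y \<in> V" by (simp add: interval_def)
  obtain c' where c': "sq x a b c'" "gd y a = Suc (gd y c')"
    using quadrangle[OF yV, of x a b] sq_neq[OF assms(3)] interval_lower_dist assms(1,2) y
    by (metis (no_types, lifting) IntD1 IntD2 lower_def mem_Collect_eq)
  then have "c' = c" using assms(3) sq_unique by blast
  with c' y assms(4) show "y \<in> interval c" by (auto simp: interval_def lower_def)
next
  fix y assume "y \<in> interval c"
  moreover have "c \<in> lower b"
    using assms sq_adj2[OF sq_swap[OF assms(3)]] by (auto simp: lower_def)
  ultimately show "y \<in> interval a \<inter> interval b"
    using interval_lower_subset assms(4) by blast
qed

text \<open>A vertex \<open>y\<close> with fewer than \<open>N\<close> lower neighbours also receives the mass that an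
  \<open>N\<close>-dimensional orthant would place in the missing directions; this makes the total mass
  independent of \<open>x\<close>.\<close>

definition weight :: "int \<Rightarrow> 'a \<Rightarrow> 'a \<Rightarrow> real" where
  "weight l x y = mass (N - card (lower y)) (l - (int (gd u x) - int (gd u y)))"

lemma weight_lower: "a \<in> lower x \<Longrightarrow> weight l x y = weight (l - 1) a y"
  by (simp add: weight_def lower_def algebra_simps)

text \<open>In the orthant picture, the union consists of the monomials divisible by one of
  \<open>card S\<close> chosen variables, and the subtracted term counts those in the other
  variables. Inclusion and exclusion adds one lower neighbour \<open>b\<close> at a time; the
  overlap with the earlier intervals is a union of the same kind below \<open>b\<close>, with
  \<open>l\<close> lowered by 1.\<close>

lemma weight_sum_union:
  assumes total: "\<And>a l. a \<in> lower x \<Longrightarrow> sum (weight l a) (interval a) = mass N l"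
    and unions: "\<And>a S l. \<lbrakk>a \<in> lower x; S \<subseteq> lower a\<rbrakk> \<Longrightarrow>
          sum (weight l a) (\<Union>(interval ` S)) = mass N l - mass (N - card S) l"
    and S: "S \<subseteq> lower x"
  shows "sum (weight l x) (\<Union>(interval ` S)) = mass N l - mass (N - card S) l"
proof -
  have "finite S" using S finite_lower finite_subset by blast
  then show ?thesis using S
  proof (induction S)
    case empty
    then show ?case by simp
  next
    case (insert b S)
    have b: "b \<in> lower x" using insert by simp
    have "\<forall>a\<in>S. \<exists>c. sq x b a c \<and> c \<in> lower b"
      using insert lower_square[OF b] by (metis insertCI subset_iff)
    then obtain e where e: "\<And>a. a \<in> S \<Longrightarrow> sq x b a (e a) \<and> e a \<in> lower b" by metis
    have "inj_on e S"
      by (intro inj_onI) (metis e sq_rot sq_unique)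
    then have card_e: "card (e ` S) = card S" by (rule card_image)
    have fin: "finite (interval a)" if "a \<in> lower x" for a
      using that lower_V finite_interval by blast
    have "interval b \<inter> interval a = interval (e a)" if "a \<in> S" for a
      using that e insert.prems by (intro interval_inter) auto
    then have Int: "interval b \<inter> \<Union>(interval ` S) = \<Union>(interval ` e ` S)" by auto
    \<comment> \<open>By \<open>card_lower\<close> the truncated subtraction is exact, so Pascal's
      rule applies to the two subtracted terms.\<close>
    have k: "N - card S = Suc (N - card (insert b S))"
      using card_mono[OF finite_lower insert.prems] card_lower[of x] insert.hyps by simp
    have "sum (weight l x) (\<Union>(interval ` insert b S)) =
        sum (weight l x) (interval b) + sum (weight l x) (\<Union>(interval ` S))
        - sum (weight l x) (interval b \<inter> \<Union>(interval ` S))"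
      using insert fin by (subst sum_Un[symmetric]) auto
    also have "sum (weight l x) (interval b) = mass N (l - 1)"
      using total[OF b] weight_lower[OF b] by simp
    also have "sum (weight l x) (\<Union>(interval ` S)) = mass N l - mass (N - card S) l"
      using insert by auto
    also have "sum (weight l x) (interval b \<inter> \<Union>(interval ` S))
        = mass N (l - 1) - mass (N - card S) (l - 1)"
    proof -
      have "e ` S \<subseteq> lower b" using e by blast
      then show ?thesis
        unfolding Int using unions[OF b, of "e ` S" "l - 1"] weight_lower[OF b, of l] card_e by simp
    qed
    finally show ?case
      unfolding k by (simp add: mass_Suc[of _ l])
  qed
qed

text \<open>The union formula at \<open>x\<close> uses both formulas at the lower neighbours. For
  \<open>S = lower x\<close> it falls short of \<open>mass N l\<close> by exactly the weight of
  \<open>x\<close> itself, which gives the total at \<open>x\<close>.\<close>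

lemma weight_sum_joint:
  "x \<in> V \<Longrightarrow> (\<forall>l. sum (weight l x) (interval x) = mass N l) \<and>
     (\<forall>S l. S \<subseteq> lower x \<longrightarrow>
        sum (weight l x) (\<Union>(interval ` S)) = mass N l - mass (N - card S) l)"
proof (induction "gd u x" arbitrary: x rule: less_induct)
  case less
  have IH: "(\<forall>l. sum (weight l a) (interval a) = mass N l) \<and>
     (\<forall>S l. S \<subseteq> lower a \<longrightarrow>
        sum (weight l a) (\<Union>(interval ` S)) = mass N l - mass (N - card S) l)" if "a \<in> lower x" for a
  proof (rule less.hyps)
    show "gd u a < gd u x" using that by (simp add: lower_def)
  qed (use lower_V[OF that] in blast)
  have U: "sum (weight l x) (\<Union>(interval ` S)) = mass N l - mass (N - card S) l"
    if "S \<subseteq> lower x" for S l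
    by (rule weight_sum_union) (use IH that in blast)+
  have "sum (weight l x) (interval x) = mass N l" for l
  proof -
    have "finite (\<Union>(interval ` lower x))"
      using finite_lower finite_interval lower_V by blast
    moreover have "x \<notin> \<Union>(interval ` lower x)" using not_in_interval_lower by blast
    ultimately show ?thesis
      using U[of "lower x" l] less.prems by (simp add: interval_eq weight_def)
  qed
  with U show ?case by blast
qed

lemma weight_sum: "x \<in> V \<Longrightarrow> sum (weight l x) (interval x) = mass N l"
  using weight_sum_joint by blast

lemma weight_nonneg: "0 \<le> weight l x y"
  by (simp add: weight_def mass_nonneg)

section \<open>Normalised masses and their variation along edges\<close>

definition spread :: "int \<Rightarrow> 'a \<Rightarrow> 'a \<Rightarrow> real" where
  "spread l x y = (if y \<in> interval x then weight l x y / mass N l else 0)"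

lemma spread_support:
  "\<lbrakk>x \<in> V; spread l x y \<noteq> 0\<rbrakk> \<Longrightarrow> y \<in> interval x \<and> int (gd x y) \<le> l"
  by (auto simp: spread_def weight_def mass_def interval_def gd_sym[of x y] split: if_splits)

lemma spread_sum:
  assumes "x \<in> V" "l \<ge> 0" "finite A" "interval x \<subseteq> A"
  shows "(\<Sum>y\<in>A. \<bar>spread l x y\<bar>) = 1"
proof -
  have "mass N l > 0" using assms(2) by (simp add: mass_def)
  have "(\<Sum>y\<in>A. \<bar>spread l x y\<bar>) = (\<Sum>y\<in>interval x. weight l x y / mass N l)"
    using assms by (intro sum.mono_neutral_cong_right)
      (auto simp: spread_def weight_nonneg mass_nonneg)
  also have "\<dots> = 1"
    using weight_sum[OF assms(1)] \<open>mass N l > 0\<close> by (simp flip: sum_divide_distrib)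
  finally show ?thesis .
qed

text \<open>On the interval of \<open>a\<close> the weights of \<open>x\<close> are those of
  \<open>a\<close> with parameter \<open>l - 1\<close>, hence smaller than those with parameter
  \<open>l\<close>. Since both totals are \<open>M\<close>, the loss there equals the mass of
  \<open>x\<close> outside that interval: each is \<open>M - mass N (l - 1)\<close>, which accounts
  for the factor 2.\<close>

lemma spread_lower:
  assumes a: "a \<in> lower x" and "l > 0" "finite A" "interval x \<subseteq> A"
  shows "(\<Sum>y\<in>A. \<bar>spread l x y - spread l a y\<bar>) \<le> 2 * N / l"
proof -
  define M where "M = mass N l"
  have M: "M > 0" using assms(2) by (simp add: M_def mass_def)
  have V: "x \<in> V" "a \<in> V" using lower_V[OF a] by auto
  have sub: "interval a \<subseteq> interval x" using interval_lower_subset a by blast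
  have fin: "finite (interval x)" using V finite_interval by blast
  have inside: "\<bar>spread l x y - spread l a y\<bar> = (weight l a y - weight l x y) / M" if "y \<in> interval a" for y
  proof -
    have "weight l x y \<le> weight l a y"
      using mass_mono[of _ "l - (int (gd u a) - int (gd u y))"]
      unfolding weight_lower[OF a] unfolding weight_def by (simp add: algebra_simps)
    then show ?thesis using that sub M by (auto simp: spread_def M_def abs_if field_simps)
  qed
  have "(\<Sum>y\<in>A. \<bar>spread l x y - spread l a y\<bar>) = (\<Sum>y\<in>interval x. \<bar>spread l x y - spread l a y\<bar>)"
    using assms sub by (intro sum.mono_neutral_right) (auto simp: spread_def)
  also have "\<dots> = (\<Sum>y\<in>interval x - interval a. \<bar>spread l x y - spread l a y\<bar>)
      + (\<Sum>y\<in>interval a. \<bar>spread l x y - spread l a y\<bar>)"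
    using sum.subset_diff[OF sub fin] by simp
  also have "(\<Sum>y\<in>interval x - interval a. \<bar>spread l x y - spread l a y\<bar>)
      = (\<Sum>y\<in>interval x - interval a. weight l x y / M)"
    using M by (intro sum.cong) (auto simp: spread_def M_def weight_nonneg)
  also have "\<dots> = (M - mass N (l - 1)) / M"
    using weight_sum[OF V(1), of l] weight_sum[OF V(2), of "l - 1"] weight_lower[OF a, of l]
    by (simp add: M_def sum_diff[OF fin sub] flip: sum_divide_distrib)
  also have "(\<Sum>y\<in>interval a. \<bar>spread l x y - spread l a y\<bar>)
      = (\<Sum>y\<in>interval a. (weight l a y - weight l x y) / M)"
    using inside by (intro sum.cong) auto
  also have "\<dots> = (M - mass N (l - 1)) / M"
    using weight_sum[OF V(2), of l] weight_sum[OF V(2), of "l - 1"] weight_lower[OF a, of l]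
    by (simp add: M_def sum_subtractf flip: sum_divide_distrib)
  finally have "(\<Sum>y\<in>A. \<bar>spread l x y - spread l a y\<bar>) = 2 * (M - mass N (l - 1)) / M" by simp
  also have "\<dots> \<le> 2 * (N / l * M) / M"
    using mass_difference[OF assms(2), of N] M unfolding M_def
    by (intro divide_right_mono mult_left_mono) auto
  finally show ?thesis using M by simp
qed

lemma spread_adjacent:
  assumes "(x, w) \<in> E" "l > 0" "finite A" "interval x \<union> interval w \<subseteq> A"
  shows "(\<Sum>y\<in>A. \<bar>spread l x y - spread l w y\<bar>) \<le> 2 * N / l"
proof -
  from gd_adjacent[OF u assms(1)] consider "w \<in> lower x" | "x \<in> lower w"
    using assms(1) sym_E by (auto simp: lower_def)
  then show ?thesis
  proof cases
    case 2
    with assms show ?thesis using spread_lower[of x w l A] by (simp add: abs_minus_commute)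
  qed (use assms spread_lower in auto)
qed

lemma spread_relpow:
  assumes "x \<in> V" "(x, w) \<in> E ^^ n" "l > 0"
  shows "(\<Sum>y\<in>interval x \<union> interval w. \<bar>spread l x y - spread l w y\<bar>) \<le> n * (2 * N / l)"
  using assms(2)
proof (induction n arbitrary: w)
  case 0
  then show ?case by simp
next
  case (Suc n)
  then obtain v where v: "(x, v) \<in> E ^^ n" "(v, w) \<in> E" by auto
  have V: "v \<in> V" "w \<in> V" using v E_subset by auto
  define A where "A = interval x \<union> interval v \<union> interval w"
  have fin: "finite A" using V assms(1) finite_interval by (simp add: A_def)
  have "(\<Sum>y\<in>interval x \<union> interval w. \<bar>spread l x y - spread l w y\<bar>)
      \<le> (\<Sum>y\<in>A. \<bar>spread l x y - spread l w y\<bar>)"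
    using fin by (intro sum_mono2) (auto simp: A_def)
  also have "\<dots> \<le> (\<Sum>y\<in>A. \<bar>spread l x y - spread l v y\<bar> + \<bar>spread l v y - spread l w y\<bar>)"
    by (intro sum_mono) linarith
  also have "\<dots> = (\<Sum>y\<in>interval x \<union> interval v. \<bar>spread l x y - spread l v y\<bar>)
      + (\<Sum>y\<in>A. \<bar>spread l v y - spread l w y\<bar>)"
    using fin by (subst sum.distrib, intro arg_cong2[where f = "(+)"] sum.mono_neutral_right)
      (auto simp: A_def spread_def)
  also have "\<dots> \<le> n * (2 * N / l) + 2 * N / l"
    using Suc.IH[OF v(1)] spread_adjacent[OF v(2) assms(3) fin] by (intro add_mono) (auto simp: A_def)
  finally show ?case by (simp add: algebra_simps add_divide_distrib)
qed

end

lemma Metric_space_gd: "Metric_space V (\<lambda>u v. real (gd u v))"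
  using gd_sym gd_eq_0 gd_triangle by unfold_locales (force simp flip: of_nat_add)+

theorem property_A_gd: "property_A V (\<lambda>u v. real (gd u v))"
proof (cases "V = {}")
  case True
  then show ?thesis using Metric_space_gd unfolding property_A_def by (auto intro: exI[of _ 1])
next
  case False
  then obtain u where u: "u \<in> V" by blast
  show ?thesis
    unfolding property_A_def
  proof (intro conjI allI impI Metric_space_gd)
    fix R \<epsilon> :: real assume "R > 0" "\<epsilon> > 0"
    \<comment> \<open>Vertices at distance at most \<open>R\<close> are joined by at most
      \<open>R\<close> edges, each costing \<open>2 * N / l\<close>. The summand 1 keeps
      \<open>l\<close> positive when \<open>N = 0\<close>.\<close>
    define l :: int where "l = \<lceil>R * (2 * N) / \<epsilon>\<rceil> + 1"
    have "R * (2 * N) / \<epsilon> \<ge> 0" using \<open>R > 0\<close> \<open>\<epsilon> > 0\<close> by simp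
    then have l: "l > 0" "R * (2 * N) / \<epsilon> \<le> l" unfolding l_def by linarith+
    then have small: "R * (2 * N / l) \<le> \<epsilon>"
      using \<open>\<epsilon> > 0\<close> by (simp add: field_simps)
    let ?\<xi> = "spread u l"
    have infsum_eq: "infsum g V = sum g A" "g summable_on V"
      if "finite A" "A \<subseteq> V" "\<And>y. y \<in> V - A \<Longrightarrow> g y = 0" for g :: "'a \<Rightarrow> real" and A
    proof -
      have "infsum g V = infsum g A" using that by (intro infsum_cong_neutral) auto
      then show "infsum g V = sum g A" using that by simp
      have "g summable_on V \<longleftrightarrow> g summable_on A" using that by (intro summable_on_cong_neutral) auto
      then show "g summable_on V" using that by simp
    qed
    have IV: "interval u x \<subseteq> V" for x by (auto simp: interval_def[OF u])
    have zero: "y \<notin> interval u x \<Longrightarrow> ?\<xi> x y = 0" for x y by (simp add: spread_def[OF u])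
    have 1: "(\<lambda>z. \<bar>?\<xi> x z\<bar>) summable_on V \<and> (\<Sum>\<^sub>\<infinity>z\<in>V. \<bar>?\<xi> x z\<bar>) = 1" if "x \<in> V" for x
      using infsum_eq[of "interval u x" "\<lambda>z. \<bar>?\<xi> x z\<bar>"] spread_sum[OF u that] l(1) IV zero
        finite_interval[OF u that] by auto
    have 2: "(\<Sum>\<^sub>\<infinity>z\<in>V. \<bar>?\<xi> x z - ?\<xi> y z\<bar>) \<le> \<epsilon>" if "x \<in> V" "y \<in> V" "real (gd x y) \<le> R" for x y
    proof -
      have "(\<Sum>\<^sub>\<infinity>z\<in>V. \<bar>?\<xi> x z - ?\<xi> y z\<bar>) = (\<Sum>z\<in>interval u x \<union> interval u y. \<bar>?\<xi> x z - ?\<xi> y z\<bar>)"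
        using IV zero finite_interval[OF u] that by (intro infsum_eq) auto
      also have "\<dots> \<le> gd x y * (2 * N / l)"
        using spread_relpow[OF u that(1) gd_relpow[OF that(1,2)] l(1)] by simp
      also have "\<dots> \<le> R * (2 * N / l)"
        using that(3) l(1) by (intro mult_right_mono) auto
      finally show ?thesis using small by linarith
    qed
    have 3: "real (gd x z) \<le> l" if "x \<in> V" "?\<xi> x z \<noteq> 0" for x z
      using spread_support[OF u that] by simp
    show "\<exists>\<xi>. (\<forall>x\<in>V. (\<lambda>z. \<bar>\<xi> x z\<bar>) summable_on V \<and> (\<Sum>\<^sub>\<infinity>z\<in>V. \<bar>\<xi> x z\<bar>) = 1) \<and>
        (\<forall>x\<in>V. \<forall>y\<in>V. real (gd x y) \<le> R \<longrightarrow> (\<Sum>\<^sub>\<infinity>z\<in>V. \<bar>\<xi> x z - \<xi> y z\<bar>) \<le> \<epsilon>) \<and>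
        (\<exists>S>0. \<forall>x\<in>V. \<forall>z\<in>V. \<xi> x z \<noteq> 0 \<longrightarrow> real (gd x z) \<le> S)"
      using 1 2 3 l(1) by (intro exI[of _ ?\<xi>] conjI exI[of _ "real_of_int l"]) auto
  qed
qed

end


section \<open>Corners and faces of cells\<close>

definition ind :: "nat set \<Rightarrow> nat \<Rightarrow> real" where
  "ind A i = (if i \<in> A then 1 else 0)"

definition flip :: "nat \<Rightarrow> nat set \<Rightarrow> nat set" where
  "flip i A = (if i \<in> A then A - {i} else insert i A)"

lemma mem_flip: "j \<in> flip i A \<longleftrightarrow> (if j = i then j \<notin> A else j \<in> A)"
  by (auto simp: flip_def)

lemma flip_flip [simp]: "flip i (flip i A) = A"
  by (auto simp: set_eq_iff mem_flip)

lemma flip_commute: "flip i (flip j A) = flip j (flip i A)"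
  by (auto simp: set_eq_iff mem_flip)

lemma flip_neq [simp]: "flip i A \<noteq> A" "A \<noteq> flip i A"
  by (auto simp: flip_def)

lemma flip_eq_iff [simp]: "flip i A = flip j A \<longleftrightarrow> i = j"
  using mem_flip by metis

lemma flip_subset [simp]: "\<lbrakk>A \<subseteq> {..<n}; i < n\<rbrakk> \<Longrightarrow> flip i A \<subseteq> {..<n}"
  by (auto simp: flip_def)

text \<open>The fourth corner of a square lies between its two neighbours in the sense required by
  \<open>corner_convex\<close>.\<close>

lemma flip_between:
  assumes "i \<noteq> j"
  shows "flip i A \<inter> flip j A \<subseteq> flip i (flip j A)" "flip i (flip j A) \<subseteq> flip i A \<union> flip j A"
  using assms by (auto simp: flip_def split: if_splits)

text \<open>The two neighbours of \<open>A\<close> differ exactly in the directions \<open>i\<close>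
  and \<open>j\<close>, so a common neighbour either undoes the flip and is \<open>A\<close>, or
  carries out both flips.\<close>

lemma flip_common_neighbour:
  assumes "flip k (flip i A) = flip l (flip j A)" "i \<noteq> j" "flip k (flip i A) \<noteq> A"
  shows "flip k (flip i A) = flip i (flip j A)"
proof -
  have "k \<noteq> i" using assms(3) by auto
  moreover have "i \<in> flip k (flip i A) \<longleftrightarrow> i \<in> flip l (flip j A)" using assms(1) by simp
  ultimately have "l = i" using assms(2) by (auto simp: mem_flip split: if_splits)
  with assms(1) show ?thesis by simp
qed

text \<open>Faces are named by a corner \<open>ind A\<close> on them and their set \<open>I\<close>
  of free directions, which displays the dimension \<open>card I\<close>. Only the part of
  \<open>A\<close> outside \<open>I\<close> matters.\<close>

definition face :: "nat \<Rightarrow> nat set \<Rightarrow> nat set \<Rightarrow> (nat \<Rightarrow> real) set" where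
  "face n A I = {x \<in> unit_cube n. \<forall>i\<in>{..<n} - I. x i = ind A i}"

lemma face_subset: "face n A I \<subseteq> unit_cube n"
  by (auto simp: face_def)

lemma face_UNIV: "face n A {..<n} = unit_cube n"
  by (auto simp: face_def)

lemma cube_face_iff: "cube_face n F \<longleftrightarrow> (\<exists>A I. A \<subseteq> {..<n} \<and> I \<subseteq> {..<n} \<and> F = face n A I)"
proof
  assume "cube_face n F"
  then obtain A B where AB: "A \<subseteq> {..<n}" "B \<subseteq> {..<n}" "A \<inter> B = {}"
    and F: "F = {x \<in> unit_cube n. (\<forall>i\<in>A. x i = 0) \<and> (\<forall>i\<in>B. x i = 1)}"
    unfolding cube_face_def by blast
  have eq: "{..<n} - ({..<n} - (A \<union> B)) = A \<union> B" using AB by blast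
  have A: "(\<forall>i\<in>A. x i = ind B i) \<longleftrightarrow> (\<forall>i\<in>A. x i = 0)" for x
    using AB(3) by (intro ball_cong refl) (auto simp: ind_def)
  have B: "(\<forall>i\<in>B. x i = ind B i) \<longleftrightarrow> (\<forall>i\<in>B. x i = 1)" for x
    by (intro ball_cong refl) (simp add: ind_def)
  have "F = face n B ({..<n} - (A \<union> B))"
    unfolding face_def F eq ball_Un A B by (rule refl)
  then show "\<exists>A I. A \<subseteq> {..<n} \<and> I \<subseteq> {..<n} \<and> F = face n A I"
    using AB(2) by (intro exI[of _ B] exI[of _ "{..<n} - (A \<union> B)"] conjI) auto
next
  assume "\<exists>A I. A \<subseteq> {..<n} \<and> I \<subseteq> {..<n} \<and> F = face n A I"
  then obtain A I where "A \<subseteq> {..<n}" "I \<subseteq> {..<n}" "F = face n A I" by blast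
  then show "cube_face n F"
    unfolding cube_face_def face_def
    by (intro exI[of _ "{..<n} - I - A"] exI[of _ "A - I"]) (auto simp: ind_def split: if_splits)
qed

lemma ind_in_cube: "A \<subseteq> {..<n} \<Longrightarrow> ind A \<in> unit_cube n"
  by (auto simp: unit_cube_def ind_def)

lemma ind_eq_iff [simp]: "ind A = ind B \<longleftrightarrow> A = B"
  by (auto simp: fun_eq_iff ind_def split: if_splits)

lemma ind_in_face: "C \<subseteq> {..<n} \<Longrightarrow> ind C \<in> face n A I \<longleftrightarrow> (\<forall>i\<in>{..<n} - I. i \<in> C \<longleftrightarrow> i \<in> A)"
  using ind_in_cube[of C n] by (auto simp: face_def ind_def split: if_splits)

lemma face_cong: "C \<subseteq> {..<n} \<Longrightarrow> ind C \<in> face n A I \<Longrightarrow> face n A I = face n C I"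
  by (auto simp: face_def ind_def ind_in_face)

lemma cube_dist_face_le:
  assumes "x \<in> face n A I" "y \<in> face n A I" "I \<subseteq> {..<n}"
  shows "cube_dist n x y \<le> sqrt (card I)"
proof -
  have "(x i - y i)\<^sup>2 \<le> (if i \<in> I then 1 else 0)" if "i < n" for i
  proof (cases "i \<in> I")
    case True
    have "0 \<le> x i" "x i \<le> 1" "0 \<le> y i" "y i \<le> 1"
      using assms that by (auto simp: face_def unit_cube_def)
    then have "\<bar>x i - y i\<bar> \<le> 1" by linarith
    with True show ?thesis by (simp add: abs_square_le_1)
  qed (use assms that in \<open>auto simp: face_def\<close>)
  then have "(\<Sum>i<n. (x i - y i)\<^sup>2) \<le> (\<Sum>i<n. if i \<in> I then 1 else 0)"
    by (intro sum_mono) auto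
  also have "\<dots> = real (card I)"
    using assms(3) by (simp add: sum.If_cases Int_absorb1)
  finally show ?thesis by (simp add: cube_dist_def L2_set_def)
qed

lemma face_diameter_attained:
  assumes "A \<subseteq> {..<n}" "I \<subseteq> {..<n}"
  shows "\<exists>x\<in>face n A I. \<exists>y\<in>face n A I. cube_dist n x y = sqrt (card I)"
proof (intro bexI)
  have "(\<Sum>i<n. (ind (A - I) i - ind (A \<union> I) i)\<^sup>2) = (\<Sum>i<n. if i \<in> I then 1 else 0)"
    by (intro sum.cong) (auto simp: ind_def)
  also have "\<dots> = real (card I)"
    using assms(2) by (simp add: sum.If_cases Int_absorb1)
  finally show "cube_dist n (ind (A - I)) (ind (A \<union> I)) = sqrt (card I)"
    by (simp add: cube_dist_def L2_set_def)
  have "A - I \<subseteq> {..<n}" "A \<union> I \<subseteq> {..<n}" using assms by auto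
  then show "ind (A - I) \<in> face n A I" "ind (A \<union> I) \<in> face n A I"
    by (auto simp: ind_in_face)
qed

text \<open>Diameters are preserved: that of the cube is \<open>sqrt m\<close>, that of the face is
  \<open>sqrt (card I)\<close>. This is how \<open>cdim\<close> of a face is computed, since
  \<open>attaching\<close> supplies only an isometry.\<close>

lemma cube_isometry_dim:
  assumes "cube_isometry m n (face n A I) h" "A \<subseteq> {..<n}" "I \<subseteq> {..<n}"
  shows "m = card I"
proof -
  have h: "h ` unit_cube m = face n A I"
    "\<And>x y. \<lbrakk>x \<in> unit_cube m; y \<in> unit_cube m\<rbrakk> \<Longrightarrow> cube_dist n (h x) (h y) = cube_dist m x y"
    using assms(1) by (auto simp: cube_isometry_def)
  obtain x y where "x \<in> unit_cube m" "y \<in> unit_cube m" "cube_dist m x y = sqrt m"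
    using face_diameter_attained[of "{}" m "{..<m}"] by (auto simp: face_UNIV)
  then have "sqrt m \<le> sqrt (card I)"
    using cube_dist_face_le[of "h x" n A I "h y"] h assms by (metis imageI)
  obtain x y where xy: "x \<in> face n A I" "y \<in> face n A I" "cube_dist n x y = sqrt (card I)"
    using face_diameter_attained assms by blast
  then obtain x' y' where "x' \<in> unit_cube m" "y' \<in> unit_cube m" "x = h x'" "y = h y'"
    using h(1) by (metis imageE)
  then have "sqrt (card I) \<le> sqrt m"
    using cube_dist_face_le[of x' m "{}" "{..<m}" y'] h(2) xy(3) by (simp add: face_UNIV)
  with \<open>sqrt m \<le> sqrt (card I)\<close> show ?thesis by simp
qed

section \<open>Corners, edges and squares of cells\<close>

context cube_complex
begin

abbreviation V :: "'p set" where
  "V \<equiv> vertices K cdim"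

abbreviation E :: "('p \<times> 'p) set" where
  "E \<equiv> edge_rel K cdim"

definition corner :: "'p set \<Rightarrow> nat set \<Rightarrow> 'p" where
  "corner c A = \<phi> c (ind A)"

definition subcell :: "'p set \<Rightarrow> nat set \<Rightarrow> nat set \<Rightarrow> 'p set" where
  "subcell c A I = \<phi> c ` face (cdim c) A I"

lemma \<phi>_inj: "c \<in> K \<Longrightarrow> inj_on (\<phi> c) (unit_cube (cdim c))"
  using char_map by (auto simp: bij_betw_def)

lemma \<phi>_image: "c \<in> K \<Longrightarrow> \<phi> c ` unit_cube (cdim c) = c"
  using char_map by (auto simp: bij_betw_def)

lemma subcell_subset: "c \<in> K \<Longrightarrow> subcell c A I \<subseteq> c"
  unfolding subcell_def using \<phi>_image face_subset by blast

lemma subcell_whole: "c \<in> K \<Longrightarrow> subcell c A {..<cdim c} = c"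
  by (simp add: subcell_def face_UNIV \<phi>_image)

lemma subcell:
  assumes "c \<in> K" "A \<subseteq> {..<cdim c}" "I \<subseteq> {..<cdim c}"
  shows "subcell c A I \<in> K" "cdim (subcell c A I) = card I"
proof -
  have "cube_face (cdim c) (face (cdim c) A I)" using assms cube_face_iff by blast
  from attaching[OF assms(1) this] cube_isometry_dim assms
  show "subcell c A I \<in> K" "cdim (subcell c A I) = card I"
    unfolding subcell_def by auto
qed

lemma inter_subcell:
  assumes "c \<in> K" "d \<in> K" "c \<inter> d \<noteq> {}"
  obtains A I where "A \<subseteq> {..<cdim c}" "I \<subseteq> {..<cdim c}" "c \<inter> d = subcell c A I"
proof -
  obtain F where F: "cube_face (cdim c) F" "c \<inter> d = \<phi> c ` F" using intersection[OF assms] by blast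
  obtain A I where "A \<subseteq> {..<cdim c}" "I \<subseteq> {..<cdim c}" "F = face (cdim c) A I"
    using F(1) unfolding cube_face_iff by (elim exE conjE)
  with F(2) that show ?thesis by (simp add: subcell_def)
qed

lemma corner_in: "\<lbrakk>c \<in> K; A \<subseteq> {..<cdim c}\<rbrakk> \<Longrightarrow> corner c A \<in> c"
  using \<phi>_image[of c] ind_in_cube unfolding corner_def by blast

lemma corner_eq_iff:
  "\<lbrakk>c \<in> K; A \<subseteq> {..<cdim c}; B \<subseteq> {..<cdim c}\<rbrakk> \<Longrightarrow> corner c A = corner c B \<longleftrightarrow> A = B"
  unfolding corner_def using inj_on_eq_iff[OF \<phi>_inj] ind_in_cube by auto

lemma corner_in_subcell:
  "\<lbrakk>c \<in> K; C \<subseteq> {..<cdim c}\<rbrakk> \<Longrightarrow>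
     corner c C \<in> subcell c A I \<longleftrightarrow> (\<forall>i\<in>{..<cdim c} - I. i \<in> C \<longleftrightarrow> i \<in> A)"
  unfolding corner_def subcell_def
  using inj_on_image_mem_iff[OF \<phi>_inj ind_in_cube face_subset] by (simp add: ind_in_face)

lemma subcell_cong:
  "\<lbrakk>c \<in> K; C \<subseteq> {..<cdim c}; corner c C \<in> subcell c A I\<rbrakk> \<Longrightarrow> subcell c A I = subcell c C I"
  using face_cong[of C "cdim c" A I] by (simp add: corner_in_subcell ind_in_face) (simp add: subcell_def)

lemma corner_vertex:
  assumes "c \<in> K" "A \<subseteq> {..<cdim c}"
  shows "corner c A \<in> V"
proof -
  have "x = ind A" if "x \<in> face (cdim c) A {}" for x
  proof
    fix i
    show "x i = ind A i"
      using that assms(2) by (cases "i < cdim c") (auto simp: face_def unit_cube_def ind_def not_less)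
  qed
  moreover have "ind A \<in> face (cdim c) A {}" using assms(2) by (simp add: ind_in_face)
  ultimately have "face (cdim c) A {} = {ind A}" by blast
  then have "subcell c A {} = {corner c A}" by (simp add: subcell_def corner_def)
  with subcell[OF assms, of "{}"] show ?thesis by (simp add: vertices_def)
qed

text \<open>The cell \<open>c\<close> meets the 0-cell \<open>{v}\<close> in a face of
  \<open>c\<close>, and every face contains a corner.\<close>

lemma vertex_corner:
  assumes "v \<in> V" "v \<in> c" "c \<in> K"
  obtains A where "A \<subseteq> {..<cdim c}" "v = corner c A"
proof -
  have v: "{v} \<in> K" using assms(1) by (simp add: vertices_def)
  have "c \<inter> {v} \<noteq> {}" using assms(2) by simp
  then obtain A I where A: "A \<subseteq> {..<cdim c}" "c \<inter> {v} = subcell c A I"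
    using inter_subcell[OF assms(3) v] by metis
  have "corner c A \<in> c \<inter> {v}"
    unfolding A(2) using corner_in_subcell[OF assms(3) A(1)] by simp
  then have "v = corner c A" by simp
  with A(1) show ?thesis by (rule that)
qed

text \<open>The intersection of the two cells is a face of \<open>c\<close>, and a coordinate fixed
  on it has the same value at \<open>A\<close>, at \<open>B\<close> and at everything between
  them.\<close>

lemma corner_convex:
  assumes "c \<in> K" "d \<in> K" "A \<subseteq> {..<cdim c}" "B \<subseteq> {..<cdim c}" "corner c A \<in> d" "corner c B \<in> d"
    and "A \<inter> B \<subseteq> C" "C \<subseteq> A \<union> B"
  shows "corner c C \<in> d"
proof -
  have C: "C \<subseteq> {..<cdim c}" using assms by auto
  have in_c: "corner c A \<in> c \<inter> d" "corner c B \<in> c \<inter> d" using assms corner_in by auto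
  then obtain D I where "c \<inter> d = subcell c D I"
    using inter_subcell[OF assms(1,2)] by (metis empty_iff)
  then have "corner c C \<in> c \<inter> d"
    using in_c assms(1,3,4,7,8) C by (auto simp: corner_in_subcell)
  then show ?thesis by simp
qed

text \<open>The two ends of \<open>e\<close> differ in its only coordinate, so this coordinate is
  free on the face \<open>e \<inter> c\<close>, which is therefore all of \<open>e\<close>.\<close>

lemma edge_subset:
  assumes e: "e \<in> edges K cdim" and "c \<in> K" "v \<in> V" "w \<in> V" "v \<noteq> w" "v \<in> e" "w \<in> e" "v \<in> c" "w \<in> c"
  shows "e \<subseteq> c"
proof -
  have eK: "e \<in> K" "cdim e = 1" using e by (auto simp: edges_def)
  obtain A B where AB: "A \<subseteq> {..<1}" "v = corner e A" "B \<subseteq> {..<1}" "w = corner e B"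
    using vertex_corner[OF assms(3,6) eK(1)] vertex_corner[OF assms(4,7) eK(1)] eK(2) by metis
  obtain D I where D: "I \<subseteq> {..<1}" "e \<inter> c = subcell e D I"
    using inter_subcell[OF eK(1) assms(2)] assms(6,8) eK(2) by (metis IntI empty_iff)
  have "corner e A \<in> subcell e D I" "corner e B \<in> subcell e D I"
    using AB D(2) assms(6-9) by auto
  moreover have "A \<noteq> B" using AB assms(5) by auto
  then have "0 \<in> A \<longleftrightarrow> 0 \<notin> B" using AB(1,3) by auto
  ultimately have "0 \<in> I" using AB eK by (auto simp: corner_in_subcell)
  then have "I = {..<cdim e}" using D(1) eK(2) by auto
  then have "e \<inter> c = e" using D(2) subcell_whole eK(1) by simp
  then show ?thesis by blast
qed

lemma subcell_edge:
  assumes "c \<in> K" "A \<subseteq> {..<cdim c}" "i < cdim c"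
  shows "subcell c A {i} \<in> edges K cdim" "corner c A \<in> subcell c A {i}"
    "corner c (flip i A) \<in> subcell c A {i}"
  using subcell[OF assms(1,2), of "{i}"] assms
  by (auto simp: edges_def corner_in_subcell mem_flip)

lemma edge_subcell:
  assumes "c \<in> K" "A \<subseteq> {..<cdim c}" "e \<in> edges K cdim" "e \<subseteq> c" "corner c A \<in> e"
  obtains i where "i < cdim c" "e = subcell c A {i}"
proof -
  have eK: "e \<in> K" "cdim e = 1" using assms(3) by (auto simp: edges_def)
  have "c \<inter> e \<noteq> {}" using assms(4,5) by blast
  then obtain B I where B: "B \<subseteq> {..<cdim c}" "I \<subseteq> {..<cdim c}" "c \<inter> e = subcell c B I"
    using inter_subcell[OF assms(1) eK(1)] by metis
  have e: "e = subcell c B I" using B(3) assms(4) by blast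
  then have "card I = 1" using subcell(2)[OF assms(1) B(1,2)] eK(2) by simp
  then obtain i where "I = {i}" by (auto simp: card_1_singleton_iff)
  moreover have "subcell c B I = subcell c A I"
    using subcell_cong assms(1,2,5) e by blast
  ultimately show ?thesis using that B e by auto
qed

text \<open>Adjacency refers to edges anywhere in the complex; \<open>edge_subset\<close> shows that
  an edge joining two corners of \<open>c\<close> is an edge of \<open>c\<close>.\<close>

lemma adjacent_corner_iff:
  assumes "c \<in> K" "A \<subseteq> {..<cdim c}" "B \<subseteq> {..<cdim c}"
  shows "(corner c A, corner c B) \<in> E \<longleftrightarrow> (\<exists>i<cdim c. B = flip i A)"
proof
  assume "(corner c A, corner c B) \<in> E"
  then obtain e where e: "e \<in> edges K cdim" "corner c A \<in> e" "corner c B \<in> e"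
      "corner c A \<noteq> corner c B"
    unfolding edge_rel_def by auto
  then have "e \<subseteq> c" using edge_subset corner_vertex corner_in assms by meson
  then obtain i where i: "i < cdim c" "e = subcell c A {i}"
    using edge_subcell assms(1,2) e by metis
  then have *: "\<forall>j\<in>{..<cdim c} - {i}. j \<in> B \<longleftrightarrow> j \<in> A"
    using e(3) assms by (simp add: corner_in_subcell)
  have "A \<noteq> B" using e(4) by auto
  then have i_B: "i \<in> B \<longleftrightarrow> i \<notin> A" using * assms(2,3) by blast
  have "B = flip i A"
  proof (rule set_eqI)
    fix j
    have "j \<in> B \<or> j \<in> A \<Longrightarrow> j < cdim c" using assms(2,3) by blast
    then show "j \<in> B \<longleftrightarrow> j \<in> flip i A" using * i_B mem_flip[of j i A] by auto
  qed
  then show "\<exists>i<cdim c. B = flip i A" using i(1) by blast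
next
  assume "\<exists>i<cdim c. B = flip i A"
  then obtain i where i: "i < cdim c" "B = flip i A" by blast
  then show "(corner c A, corner c B) \<in> E"
    using subcell_edge[OF assms(1,2) i(1)] assms corner_vertex
    by (auto simp: edge_rel_def corner_eq_iff)
qed

lemma neighbour_corner:
  assumes "c \<in> K" "A \<subseteq> {..<cdim c}" "(corner c A, w) \<in> E" "w \<in> c"
  obtains i where "i < cdim c" "w = corner c (flip i A)"
proof -
  have "w \<in> V" using assms(3) by (auto simp: edge_rel_def)
  then obtain B where "B \<subseteq> {..<cdim c}" "w = corner c B"
    using vertex_corner assms(1,4) by blast
  with assms adjacent_corner_iff that show ?thesis by blast
qed

lemma E_sym: "(v, w) \<in> E \<Longrightarrow> (w, v) \<in> E"
  by (auto simp: edge_rel_def)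

text \<open>Squares are read off inside cells \<open>d\<close> of any dimension, so that the squares
  of a large cell are available without passing to its faces.\<close>

definition sq :: "'p \<Rightarrow> 'p \<Rightarrow> 'p \<Rightarrow> 'p \<Rightarrow> bool" where
  "sq x a b c \<longleftrightarrow> (\<exists>d\<in>K. \<exists>A\<subseteq>{..<cdim d}. \<exists>i<cdim d. \<exists>j<cdim d. i \<noteq> j \<and>
     x = corner d A \<and> a = corner d (flip i A) \<and> b = corner d (flip j A) \<and>
     c = corner d (flip i (flip j A)))"

lemma sqI:
  "\<lbrakk>d \<in> K; A \<subseteq> {..<cdim d}; i < cdim d; j < cdim d; i \<noteq> j\<rbrakk> \<Longrightarrow>
    sq (corner d A) (corner d (flip i A)) (corner d (flip j A)) (corner d (flip i (flip j A)))"
  unfolding sq_def by blast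

text \<open>By convexity the opposite corner in \<open>d\<close> also belongs to \<open>d'\<close>.
  There it is a common neighbour of the two middle corners, and \<open>flip_common_neighbour\<close>
  leaves one possibility.\<close>

lemma sq_corner_unique:
  assumes "d \<in> K" "A \<subseteq> {..<cdim d}" "i < cdim d" "j < cdim d" "i \<noteq> j"
    and "sq (corner d A) (corner d (flip i A)) (corner d (flip j A)) c"
  shows "c = corner d (flip i (flip j A))"
proof -
  obtain d' A' i' j' where d': "d' \<in> K" "A' \<subseteq> {..<cdim d'}" "i' < cdim d'" "j' < cdim d'" "i' \<noteq> j'"
    and x: "corner d A = corner d' A'" and a: "corner d (flip i A) = corner d' (flip i' A')"
    and b: "corner d (flip j A) = corner d' (flip j' A')" and c: "c = corner d' (flip i' (flip j' A'))"
    using assms(6) unfolding sq_def by blast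
  have "corner d (flip i A) \<in> d'" "corner d (flip j A) \<in> d'"
    using a b d' corner_in by auto
  then have in_d': "corner d (flip i (flip j A)) \<in> d'"
    using corner_convex[OF assms(1) d'(1) _ _ _ _ flip_between[OF assms(5)]] assms(2-4) by simp
  then obtain C where C: "C \<subseteq> {..<cdim d'}" "corner d (flip i (flip j A)) = corner d' C"
    using vertex_corner[OF corner_vertex in_d' d'(1)] assms by auto
  have "(corner d' (flip i' A'), corner d' C) \<in> E" "(corner d' (flip j' A'), corner d' C) \<in> E"
    unfolding C(2)[symmetric] a[symmetric] b[symmetric]
    using assms(1-4) flip_commute[of i j A] by (auto simp: adjacent_corner_iff)
  then have "\<exists>k<cdim d'. C = flip k (flip i' A')" "\<exists>k<cdim d'. C = flip k (flip j' A')"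
    using adjacent_corner_iff[OF d'(1) flip_subset[OF d'(2,3)] C(1)]
      adjacent_corner_iff[OF d'(1) flip_subset[OF d'(2,4)] C(1)] by (simp_all only:)
  then obtain k l where "C = flip k (flip i' A')" "C = flip l (flip j' A')" by (elim exE conjE)
  moreover have "flip i (flip j A) \<noteq> A"
    using assms(5) mem_flip by metis
  then have "C \<noteq> A'"
    using C(2) x assms by (metis corner_eq_iff flip_subset)
  ultimately have "C = flip i' (flip j' A')"
    using flip_common_neighbour d'(5) by metis
  with C c show ?thesis by simp
qed

text \<open>The simplex is contributed by the face \<open>subcell c A I\<close>, whose edges at the
  corner are those in the directions \<open>I\<close>.\<close>

lemma link_subcells:
  assumes "c \<in> K" "A \<subseteq> {..<cdim c}" "I \<subseteq> {..<cdim c}" "I \<noteq> {}"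
  shows "(\<lambda>i. subcell c A {i}) ` I \<in> link K cdim (corner c A)"
proof -
  let ?d = "subcell c A I"
  have "finite I" using assms(3) finite_subset by blast
  then have d: "?d \<in> K" "cdim ?d \<ge> 1"
    using subcell[OF assms(1-3)] assms(4) by (auto simp: Suc_le_eq card_gt_0_iff)
  have x: "corner c A \<in> ?d" using assms by (simp add: corner_in_subcell)
  have "{e \<in> edges K cdim. corner c A \<in> e \<and> e \<subseteq> ?d} = (\<lambda>i. subcell c A {i}) ` I"
  proof (intro equalityI subsetI)
    fix e assume "e \<in> {e \<in> edges K cdim. corner c A \<in> e \<and> e \<subseteq> ?d}"
    then have e: "e \<in> edges K cdim" "corner c A \<in> e" "e \<subseteq> ?d" by auto
    then have "e \<subseteq> c" using subcell_subset assms(1) by blast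
    then obtain i where i: "i < cdim c" "e = subcell c A {i}"
      using edge_subcell assms(1,2) e by metis
    then have "corner c (flip i A) \<in> ?d" using subcell_edge[OF assms(1,2) i(1)] e by blast
    then have "\<forall>k\<in>{..<cdim c} - I. k \<in> flip i A \<longleftrightarrow> k \<in> A"
      using assms i(1) by (simp add: corner_in_subcell)
    then have "i \<in> I" using i(1) mem_flip[of i i A] by auto
    with i show "e \<in> (\<lambda>i. subcell c A {i}) ` I" by blast
  next
    fix e assume "e \<in> (\<lambda>i. subcell c A {i}) ` I"
    then obtain i where i: "i \<in> I" "e = subcell c A {i}" by blast
    then have "face (cdim c) A {i} \<subseteq> face (cdim c) A I" by (auto simp: face_def)
    then have "e \<subseteq> ?d" using i by (auto simp: subcell_def)
    then show "e \<in> {e \<in> edges K cdim. corner c A \<in> e \<and> e \<subseteq> ?d}"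
      using i subcell_edge[OF assms(1,2), of i] assms(3) by auto
  qed
  then show ?thesis using d x unfolding link_def by blast
qed

lemma sq_axioms:
  shows "sq x a b c \<Longrightarrow> (x, a) \<in> E"
    and "sq x a b c \<Longrightarrow> a \<noteq> b"
    and "sq x a b c \<Longrightarrow> sq x b a c"
    and "sq x a b c \<Longrightarrow> sq a x c b"
    and "\<lbrakk>sq x a b c; sq x a b c'\<rbrakk> \<Longrightarrow> c = c'"
proof -
  assume "sq x a b c"
  then obtain d A i j where d: "d \<in> K" "A \<subseteq> {..<cdim d}" "i < cdim d" "j < cdim d" "i \<noteq> j"
    and x: "x = corner d A" "a = corner d (flip i A)" "b = corner d (flip j A)"
      "c = corner d (flip i (flip j A))"
    unfolding sq_def by blast
  show "(x, a) \<in> E" using d x by (auto simp: adjacent_corner_iff)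
  show "a \<noteq> b" using d x by (simp add: corner_eq_iff)
  show "sq x b a c" using sqI[of d A j i] d x by (simp add: flip_commute)
  show "sq a x c b" using sqI[of d "flip i A" i j] d x by (simp add: flip_commute[of j i])
  show "c = c'" if "sq x a b c'" using sq_corner_unique that d x by metis
qed

end

section \<open>Consequences of the flag condition\<close>

context CAT0_cube_complex
begin

text \<open>The edges from \<open>x\<close> to the elements of \<open>S\<close> are vertices of the
  link, pairwise joined because of the squares. The flag condition fills them by a simplex, that is,
  by a cell.\<close>

lemma flag_cell:
  assumes "x \<in> V" "finite S" "S \<noteq> {}" "\<forall>a\<in>S. (x, a) \<in> E"
    and squares: "\<forall>a\<in>S. \<forall>b\<in>S. a \<noteq> b \<longrightarrow> (\<exists>c. sq x a b c)"
  obtains c where "c \<in> K" "x \<in> c" "S \<subseteq> c"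
proof -
  have "\<forall>a\<in>S. \<exists>e. e \<in> edges K cdim \<and> x \<in> e \<and> a \<in> e"
    using assms(4) by (auto simp: edge_rel_def)
  then obtain e where e: "\<And>a. a \<in> S \<Longrightarrow> e a \<in> edges K cdim \<and> x \<in> e a \<and> a \<in> e a" by metis
  have "{e a, e b} \<in> link K cdim x" if ab: "a \<in> S" "b \<in> S" for a b
  proof (cases "a = b")
    case True
    have ea: "e a \<in> K" "cdim (e a) = 1" using e[OF ab(1)] by (auto simp: edges_def)
    then obtain A where A: "A \<subseteq> {..<cdim (e a)}" "x = corner (e a) A"
      using vertex_corner assms(1) e[OF ab(1)] by blast
    have "{..<1::nat} = {0}" by auto
    then have "subcell (e a) A {0} = e a" using subcell_whole[OF ea(1)] ea(2) by metis
    then show ?thesis using link_subcells[OF ea(1) A(1), of "{0}"] ea(2) A(2) True by simp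
  next
    case False
    then obtain d A i j where d: "d \<in> K" "A \<subseteq> {..<cdim d}" "i < cdim d" "j < cdim d"
      and x: "x = corner d A" "a = corner d (flip i A)" "b = corner d (flip j A)"
      using squares ab unfolding sq_def by meson
    \<comment> \<open>The chosen edge and the edge of \<open>d\<close> have the same two ends, so
      each contains the other by \<open>edge_subset\<close>.\<close>
    have edge_eq: "e y = subcell d A {k}" if "y \<in> S" "k < cdim d" "y = corner d (flip k A)" for y k
    proof -
      have V: "y \<in> V" "y \<noteq> x" "y \<in> d" using assms(4) that(1,3) d x corner_in[OF d(1)] that(2) by (auto simp: edge_rel_def)
      have sub: "subcell d A {k} \<in> edges K cdim" "x \<in> subcell d A {k}" "y \<in> subcell d A {k}"
        using subcell_edge[OF d(1,2) that(2)] x that(3) by auto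
      then have "subcell d A {k} \<in> K" by (simp add: edges_def)
      moreover have "e y \<in> K" using e that(1) by (auto simp: edges_def)
      ultimately show ?thesis
        using edge_subset[of "e y" "subcell d A {k}" x y] edge_subset[of "subcell d A {k}" "e y" x y]
          e[OF that(1)] sub V assms(1) by (intro equalityI) auto
    qed
    have "e a = subcell d A {i}" "e b = subcell d A {j}"
      using edge_eq ab d x by blast+
    then show ?thesis using link_subcells[OF d(1,2), of "{i, j}"] d x by simp
  qed
  then have "\<forall>e1\<in>e ` S. \<forall>e2\<in>e ` S. {e1, e2} \<in> link K cdim x" by simp
  then have "e ` S \<in> link K cdim x"
    using link_condition[OF assms(1)] assms(2,3) unfolding flag_cplx_def
    by (elim conjE allE[of _ "e ` S"] mp) simp
  then obtain c where c: "c \<in> K" "x \<in> c" "e ` S = {e \<in> edges K cdim. x \<in> e \<and> e \<subseteq> c}"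
    unfolding link_def by blast
  have "S \<subseteq> c"
  proof
    fix a assume a: "a \<in> S"
    then have "e a \<in> {e \<in> edges K cdim. x \<in> e \<and> e \<subseteq> c}" unfolding c(3)[symmetric] by simp
    then show "a \<in> c" using e[OF a] by auto
  qed
  with c(1,2) show ?thesis by (rule that)
qed

sublocale square_graph E sq
proof
  fix x a b c p q r
  assume sq: "sq x a b p" "sq x b c q" "sq x a c r"
  then have E: "(x, a) \<in> E" "(x, b) \<in> E" "(x, c) \<in> E" using sq_axioms(1,3) by blast+
  then have "x \<in> V" by (simp add: edge_rel_def)
  have squares: "\<forall>y\<in>{a, b, c}. \<forall>z\<in>{a, b, c}. y \<noteq> z \<longrightarrow> (\<exists>w. sq x y z w)"
    using sq sq_axioms(3) by blast
  have "\<forall>y\<in>{a, b, c}. (x, y) \<in> E" using E by simp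
  then obtain d where "d \<in> K" "x \<in> d" "{a, b, c} \<subseteq> d"
    by (rule flag_cell[OF \<open>x \<in> V\<close> _ _ _ squares, rotated 2]) simp_all
  then have d: "d \<in> K" "x \<in> d" "a \<in> d" "b \<in> d" "c \<in> d" by simp_all
  then obtain A where A: "A \<subseteq> {..<cdim d}" "x = corner d A"
    using vertex_corner \<open>x \<in> V\<close> by blast
  obtain i where i: "i < cdim d" "a = corner d (flip i A)"
    using neighbour_corner[OF d(1) A(1)] A(2) \<open>(x, a) \<in> E\<close> d(3) by blast
  obtain j where j: "j < cdim d" "b = corner d (flip j A)"
    using neighbour_corner[OF d(1) A(1)] A(2) \<open>(x, b) \<in> E\<close> d(4) by blast
  obtain k where k: "k < cdim d" "c = corner d (flip k A)"
    using neighbour_corner[OF d(1) A(1)] A(2) \<open>(x, c) \<in> E\<close> d(5) by blast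
  have neq: "i \<noteq> j" "j \<noteq> k" "i \<noteq> k"
    using sq_axioms(2)[OF sq(1)] sq_axioms(2)[OF sq(2)] sq_axioms(2)[OF sq(3)] i j k by auto
  have p: "p = corner d (flip i (flip j A))"
    using sq_corner_unique[OF d(1) A(1) i(1) j(1) neq(1)] sq(1) A i j by simp
  have q: "q = corner d (flip j (flip k A))"
    using sq_corner_unique[OF d(1) A(1) j(1) k(1) neq(2)] sq(2) A j k by simp
  have r: "r = corner d (flip i (flip k A))"
    using sq_corner_unique[OF d(1) A(1) i(1) k(1) neq(3)] sq(3) A i k by simp
  let ?g = "corner d (flip i (flip j (flip k A)))"
  have "sq a p r ?g"
    using sqI[of d "flip i A" j k] d A i j k neq p r by (simp add: flip_commute[of _ i])
  moreover have "sq b p q ?g"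
    using sqI[of d "flip j A" i k] d A i j k neq p q by (simp add: flip_commute[of _ j])
  moreover have "sq c r q ?g"
    using sqI[of d "flip k A" i j] d A i j k neq q r by simp
  ultimately show "\<exists>g. sq a p r g \<and> sq b p q g \<and> sq c r q g" by blast
qed (fact E_sym sq_axioms)+

text \<open>The flag condition puts all of \<open>S\<close> into one cell, and \<open>x\<close> has
  only \<open>cdim c\<close> neighbours in a cell \<open>c\<close>.\<close>

lemma sq_card_le:
  assumes "finite S" "\<forall>a\<in>S. (x, a) \<in> E" "\<forall>a\<in>S. \<forall>b\<in>S. a \<noteq> b \<longrightarrow> (\<exists>c. sq x a b c)"
    and "\<And>c. c \<in> K \<Longrightarrow> cdim c \<le> N"
  shows "card S \<le> N"
proof (cases "S = {}")
  case False
  then have "x \<in> V" using assms(2) by (auto simp: edge_rel_def)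
  then obtain c where c: "c \<in> K" "x \<in> c" "S \<subseteq> c" using flag_cell assms False by metis
  obtain A where A: "A \<subseteq> {..<cdim c}" "x = corner c A"
    using vertex_corner \<open>x \<in> V\<close> c by blast
  have "S \<subseteq> (\<lambda>i. corner c (flip i A)) ` {..<cdim c}"
  proof
    fix a assume "a \<in> S"
    then have "(corner c A, a) \<in> E" "a \<in> c" using assms(2) A(2) c(3) by auto
    then obtain i where "i < cdim c" "a = corner c (flip i A)"
      using neighbour_corner[OF c(1) A(1)] by blast
    then show "a \<in> (\<lambda>i. corner c (flip i A)) ` {..<cdim c}" by simp
  qed
  then have "card S \<le> cdim c" using surj_card_le by (metis card_lessThan finite_lessThan)
  then show ?thesis using assms(4) c(1) le_trans by blast
qed simp

end


section \<open>Local systems on cells\<close>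

primrec carry :: "('v \<Rightarrow> 'v \<Rightarrow> 'f \<Rightarrow> 'f) \<Rightarrow> (nat \<Rightarrow> 'v) \<Rightarrow> 'f \<Rightarrow> nat \<Rightarrow> 'f" where
  "carry tr w f 0 = f"
| "carry tr w f (Suc j) = tr (w j) (w (Suc j)) (carry tr w f j)"

context CAT0_cube_complex
begin

context
  fixes F :: "'p \<Rightarrow> 'f set" and act :: "'p \<Rightarrow> 'p \<Rightarrow> 'f \<Rightarrow> 'f"
  assumes local_system: "local_system E sq F act"
begin

lemma act_in: "\<lbrakk>(v, w) \<in> E; f \<in> F v\<rbrakk> \<Longrightarrow> act v w f \<in> F w"
  and act_back: "\<lbrakk>(v, w) \<in> E; f \<in> F v\<rbrakk> \<Longrightarrow> act w v (act v w f) = f"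
  and act_square: "\<lbrakk>sq x a b c; f \<in> F x\<rbrakk> \<Longrightarrow> act a c (act x a f) = act b c (act x b f)"
  using local_system unfolding local_system_def by auto

section \<open>Flat sections over cells\<close>

definition flat :: "'p set \<Rightarrow> ('p \<Rightarrow> 'f) \<Rightarrow> bool" where
  "flat d s \<longleftrightarrow> (\<forall>v\<in>V \<inter> d. s v \<in> F v) \<and> (\<forall>v\<in>V \<inter> d. \<forall>w\<in>V \<inter> d. (v, w) \<in> E \<longrightarrow> act v w (s v) = s w)"

text \<open>One coordinate is added at a time. A corner with the new coordinate gets the value
  transported from its projection; an edge between two such corners closes a square, where
  \<open>act_square\<close> applies. Edges are recorded in the direction that adds a coordinate, and
  \<open>act_back\<close> supplies the reverses in \<open>flat_from_origin\<close>.\<close>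

lemma flat_from_origin_subcube:
  assumes d: "d \<in> K" and f: "f \<in> F (corner d {})" and "k \<le> cdim d"
  shows "\<exists>t. t {} = f \<and> (\<forall>A\<subseteq>{..<k}. t A \<in> F (corner d A) \<and>
           (\<forall>i<k. i \<notin> A \<longrightarrow> act (corner d A) (corner d (insert i A)) (t A) = t (insert i A)))"
  using assms(3)
proof (induction k)
  case 0
  then show ?case using f by (intro exI[of _ "\<lambda>_. f"]) auto
next
  case (Suc k)
  then obtain t where t0: "t {} = f" and tF: "\<And>A. A \<subseteq> {..<k} \<Longrightarrow> t A \<in> F (corner d A)"
    and tact: "\<And>A i. \<lbrakk>A \<subseteq> {..<k}; i < k; i \<notin> A\<rbrakk> \<Longrightarrow> act (corner d A) (corner d (insert i A)) (t A) = t (insert i A)"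
    by auto
  define t' where "t' A = (if k \<in> A then act (corner d (A - {k})) (corner d A) (t (A - {k})) else t A)" for A
  have t'_insert: "t' (insert k B) = act (corner d B) (corner d (insert k B)) (t B)" if "B \<subseteq> {..<k}" for B
  proof -
    have "k \<notin> B" using that by auto
    then show ?thesis by (simp add: t'_def)
  qed
  have adj: "(corner d B, corner d (insert i B)) \<in> E" if "B \<subseteq> {..<Suc k}" "i < Suc k" "i \<notin> B" for B i
  proof -
    have "B \<subseteq> {..<cdim d}" "i < cdim d" using that Suc.prems by auto
    then show ?thesis using that(3) d flip_subset[of B "cdim d" i] by (auto simp: adjacent_corner_iff flip_def)
  qed
  have cases: "(A \<subseteq> {..<k}) \<or> (\<exists>B\<subseteq>{..<k}. A = insert k B)" if "A \<subseteq> {..<Suc k}" for A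
  proof (cases "k \<in> A")
    case True
    moreover have "A - {k} \<subseteq> {..<k}" using that by (auto simp: less_Suc_eq)
    ultimately show ?thesis by (metis insert_Diff)
  next
    case False
    then have "A \<subseteq> {..<k}" using that by (auto simp: less_Suc_eq)
    then show ?thesis by blast
  qed
  have t'_old: "t' A = t A" if "A \<subseteq> {..<k}" for A
  proof -
    have "k \<notin> A" using that by auto
    then show ?thesis by (simp add: t'_def)
  qed
  have "t' A \<in> F (corner d A)" if "A \<subseteq> {..<Suc k}" for A
    using cases[OF that]
  proof (elim disjE exE conjE)
    fix B assume B: "B \<subseteq> {..<k}" "A = insert k B"
    then have "k \<notin> B" "B \<subseteq> {..<Suc k}" by auto
    then show ?thesis using B act_in[OF adj tF[OF B(1)]] t'_insert by simp
  qed (simp add: t'_old tF)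
  moreover have "act (corner d A) (corner d (insert i A)) (t' A) = t' (insert i A)"
    if "A \<subseteq> {..<Suc k}" "i < Suc k" "i \<notin> A" for A i
    using cases[OF that(1)]
  proof (elim disjE exE conjE)
    assume A: "A \<subseteq> {..<k}"
    show ?thesis
    proof (cases "i = k")
      case True
      then show ?thesis using t'_old[OF A] t'_insert[OF A] by simp
    next
      case False
      then have "insert i A \<subseteq> {..<k}" "i < k" using A that by auto
      then show ?thesis using t'_old A tact that(3) by simp
    qed
  next
    fix B assume B: "B \<subseteq> {..<k}" "A = insert k B"
    then have i: "i < k" "i \<notin> B" "k \<notin> B" "i \<noteq> k" using that by auto
    have n: "B \<subseteq> {..<cdim d}" "i < cdim d" "k < cdim d" using B i Suc.prems by auto
    have fl: "flip i B = insert i B" "flip k B = insert k B" "flip k (flip i B) = insert i (insert k B)"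
      using i by (auto simp: flip_def)
    have "sq (corner d B) (corner d (insert k B)) (corner d (insert i B)) (corner d (insert i (insert k B)))"
      using sqI[OF d n(1,3,2)] i(4) fl by simp
    from act_square[OF this tF[OF B(1)]]
    have "act (corner d A) (corner d (insert i A)) (t' A)
        = act (corner d (insert i B)) (corner d (insert k (insert i B))) (t (insert i B))"
      using t'_insert[OF B(1)] tact[OF B(1) i(1,2)] B(2) by (simp add: insert_commute)
    also have "\<dots> = t' (insert i A)"
      using t'_insert[of "insert i B"] B i by (simp add: insert_commute)
    finally show ?thesis .
  qed
  moreover have "t' {} = f" using t0 by (simp add: t'_def)
  ultimately show ?case by (intro exI[of _ t']) simp
qed

lemma flat_from_origin:
  assumes d: "d \<in> K" and f: "f \<in> F (corner d {})"
  shows "\<exists>s. flat d s \<and> s (corner d {}) = f"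
proof -
  obtain t where t0: "t {} = f" and tF: "\<And>A. A \<subseteq> {..<cdim d} \<Longrightarrow> t A \<in> F (corner d A)"
    and tact: "\<And>A i. \<lbrakk>A \<subseteq> {..<cdim d}; i < cdim d; i \<notin> A\<rbrakk> \<Longrightarrow>
        act (corner d A) (corner d (insert i A)) (t A) = t (insert i A)"
    using flat_from_origin_subcube[OF d f order_refl] by auto
  define s where "s v = t (THE A. A \<subseteq> {..<cdim d} \<and> v = corner d A)" for v
  have s: "s (corner d A) = t A" if "A \<subseteq> {..<cdim d}" for A
  proof -
    have "(THE B. B \<subseteq> {..<cdim d} \<and> corner d A = corner d B) = A"
      by (rule the_equality) (use that d corner_eq_iff in auto)
    then show ?thesis by (simp add: s_def)
  qed
  have flip: "act (corner d A) (corner d (flip i A)) (t A) = t (flip i A)"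
    if A: "A \<subseteq> {..<cdim d}" "i < cdim d" for A i
  proof (cases "i \<in> A")
    case True
    have sub: "A - {i} \<subseteq> {..<cdim d}" using A by auto
    have ins: "insert i (A - {i}) = A" using True by auto
    have "(corner d (A - {i}), corner d A) \<in> E"
      using adjacent_corner_iff[OF d sub A(1)] A(2) ins by (auto simp: flip_def)
    then show ?thesis
      using tact[OF sub A(2)] act_back tF[OF sub] True ins by (metis DiffE flip_def singletonI)
  next
    case False
    then show ?thesis using tact[OF A False] by (simp add: flip_def)
  qed
  have "flat d s"
    unfolding flat_def
  proof (intro conjI ballI impI)
    fix v assume "v \<in> V \<inter> d"
    then obtain A where "A \<subseteq> {..<cdim d}" "v = corner d A" using vertex_corner d by blast
    then show "s v \<in> F v" using tF s by simp
  next
    fix v w assume "v \<in> V \<inter> d" "w \<in> V \<inter> d" "(v, w) \<in> E"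
    moreover from this obtain A where A: "A \<subseteq> {..<cdim d}" "v = corner d A" using vertex_corner d by blast
    ultimately obtain i where i: "i < cdim d" "w = corner d (flip i A)"
      using neighbour_corner[OF d A(1)] by blast
    then show "act v w (s v) = s w"
      using flip[OF A(1) i(1)] s[OF A(1)] s[OF flip_subset[OF A(1) i(1)]] A(2) by simp
  qed
  moreover have "s (corner d {}) = f" using s[of "{}"] t0 by simp
  ultimately show ?thesis by blast
qed

text \<open>The prescribed value is carried back to the origin, one coordinate of \<open>A\<close>
  after the other.\<close>

lemma flat_corner_exists:
  assumes d: "d \<in> K" and "A \<subseteq> {..<cdim d}" "f \<in> F (corner d A)"
  shows "\<exists>s. flat d s \<and> s (corner d A) = f"
proof -
  have "finite A" using assms(2) finite_subset by blast
  then show ?thesis using assms(2,3)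
  proof (induction A arbitrary: f)
    case empty
    then show ?case using flat_from_origin d by blast
  next
    case (insert i A)
    then have A: "A \<subseteq> {..<cdim d}" "flip i A = insert i A" by (auto simp: flip_def)
    have adj: "(corner d A, corner d (insert i A)) \<in> E"
      using adjacent_corner_iff[OF d A(1) insert.prems(1)] A(2) insert.prems(1) by auto
    then have adj': "(corner d (insert i A), corner d A) \<in> E" by (rule E_sym)
    obtain s where s: "flat d s" "s (corner d A) = act (corner d (insert i A)) (corner d A) f"
      using insert.IH[OF A(1) act_in[OF adj' insert.prems(2)]] by blast
    have "corner d A \<in> V \<inter> d" "corner d (insert i A) \<in> V \<inter> d"
      using corner_vertex corner_in d A(1) insert.prems(1) by auto
    then have "s (corner d (insert i A)) = act (corner d A) (corner d (insert i A)) (s (corner d A))"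
      using s(1) adj unfolding flat_def by simp
    also have "\<dots> = f" using s(2) act_back[OF adj' insert.prems(2)] by simp
    finally show ?case using s(1) by blast
  qed
qed

lemma flat_exists:
  assumes "d \<in> K" "v \<in> V" "v \<in> d" "f \<in> F v"
  obtains s where "flat d s" "s v = f"
proof -
  obtain A where "A \<subseteq> {..<cdim d}" "v = corner d A" using vertex_corner assms(1-3) by blast
  then show ?thesis using flat_corner_exists[OF assms(1), of A f] assms(4) that by blast
qed

text \<open>The corners on the way from \<open>A\<close> to \<open>B\<close> stay in
  \<open>d'\<close> by convexity, so agreement spreads along edges common to both cells. Allowing
  two different cells is what makes \<open>transport\<close> independent of the cell.\<close>

lemma flat_corner_unique:
  assumes d: "d \<in> K" "d' \<in> K" "flat d s" "flat d' s'"
    and B: "B \<subseteq> {..<cdim d}" "corner d B \<in> d'"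
  shows "\<lbrakk>A \<subseteq> {..<cdim d}; corner d A \<in> d'; s (corner d A) = s' (corner d A)\<rbrakk> \<Longrightarrow>
    s (corner d B) = s' (corner d B)"
proof (induction "card ((A - B) \<union> (B - A))" arbitrary: A rule: less_induct)
  case less
  show ?case
  proof (cases "A = B")
    case False
    then obtain i where i: "i \<in> (A - B) \<union> (B - A)" by blast
    let ?A = "flip i A"
    have "i < cdim d" using i B less.prems(1) by auto
    then have sub: "?A \<subseteq> {..<cdim d}" using less.prems(1) by simp
    have fin: "finite ((A - B) \<union> (B - A))"
      using B(1) less.prems(1) finite_subset[of _ "{..<cdim d}"] by blast
    have "A \<inter> B \<subseteq> ?A" "?A \<subseteq> A \<union> B" using i by (auto simp: flip_def)
    then have in_d': "corner d ?A \<in> d'"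
      using corner_convex[OF d(1,2) less.prems(1) B(1) less.prems(2) B(2)] by blast
    have adj: "(corner d A, corner d ?A) \<in> E"
      using adjacent_corner_iff[OF d(1) less.prems(1) sub] \<open>i < cdim d\<close> by blast
    have "corner d A \<in> V" "corner d ?A \<in> V" "corner d A \<in> d" "corner d ?A \<in> d"
      using corner_vertex corner_in d(1) less.prems(1) sub by auto
    then have "s (corner d ?A) = s' (corner d ?A)"
      using d(3,4) adj in_d' less.prems unfolding flat_def by (metis IntI)
    moreover have "(?A - B) \<union> (B - ?A) = ((A - B) \<union> (B - A)) - {i}"
      using i by (auto simp: flip_def split: if_splits)
    then have "card ((?A - B) \<union> (B - ?A)) < card ((A - B) \<union> (B - A))"
      using fin i by (metis card_Diff1_less)
    ultimately show ?thesis using less.hyps sub in_d' by blast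
  qed (use less.prems in simp)
qed

lemma flat_unique:
  assumes "d \<in> K" "d' \<in> K" "flat d s" "flat d' s'"
    and "v \<in> V" "v \<in> d" "v \<in> d'" "w \<in> V" "w \<in> d" "w \<in> d'" "s v = s' v"
  shows "s w = s' w"
proof -
  obtain A where A: "A \<subseteq> {..<cdim d}" "v = corner d A" using vertex_corner assms(1,5,6) by blast
  obtain B where B: "B \<subseteq> {..<cdim d}" "w = corner d B" using vertex_corner assms(1,8,9) by blast
  show ?thesis
    using flat_corner_unique[OF assms(1-4) B(1) _ A(1)] A(2) B(2) assms(7,10,11) by blast
qed

text \<open>Meaningful only if \<open>v\<close> and \<open>w\<close> lie in a common cell; then the choice of the cell and of
  the section does not matter.\<close>

definition transport :: "'p \<Rightarrow> 'p \<Rightarrow> 'f \<Rightarrow> 'f" where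
  "transport v w f = (SOME s. \<exists>d\<in>K. v \<in> d \<and> w \<in> d \<and> flat d s \<and> s v = f) w"

lemma transport_flat:
  assumes "d \<in> K" "flat d s" "v \<in> V" "v \<in> d" "w \<in> V" "w \<in> d"
  shows "transport v w (s v) = s w"
proof -
  let ?P = "\<lambda>t. \<exists>d\<in>K. v \<in> d \<and> w \<in> d \<and> flat d t \<and> t v = s v"
  have "?P s" using assms by blast
  then have "?P (SOME t. ?P t)" by (rule someI[where P = ?P])
  then obtain d' where "d' \<in> K" "v \<in> d'" "w \<in> d'" "flat d' (SOME t. ?P t)" "(SOME t. ?P t) v = s v"
    by (elim bexE conjE)
  then have "(SOME t. ?P t) w = s w"
    using flat_unique[of d' d "SOME t. ?P t" s v w] assms by simp
  then show ?thesis unfolding transport_def .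
qed

lemma transport_in:
  assumes "d \<in> K" "v \<in> V" "w \<in> V" "v \<in> d" "w \<in> d" "f \<in> F v"
  shows "transport v w f \<in> F w"
proof -
  obtain s where "flat d s" "s v = f" using flat_exists assms by blast
  then show ?thesis using transport_flat[of d s v w] assms by (auto simp: flat_def)
qed

lemma transport_trans:
  assumes "d \<in> K" "u \<in> V" "v \<in> V" "w \<in> V" "u \<in> d" "v \<in> d" "w \<in> d" "f \<in> F u"
  shows "transport v w (transport u v f) = transport u w f"
proof -
  obtain s where s: "flat d s" "s u = f" using flat_exists assms by blast
  then show ?thesis
    using transport_flat[of d s u v] transport_flat[of d s v w] transport_flat[of d s u w] assms by simp
qed

lemma transport_refl:
  assumes "v \<in> V" "f \<in> F v"
  shows "transport v v f = f"
proof -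
  have v: "{v} \<in> K" using assms by (simp add: vertices_def)
  obtain s where "flat {v} s" "s v = f" using flat_exists[OF v assms(1)] assms(2) by blast
  then show ?thesis using transport_flat[OF v, of s v v] assms by simp
qed

lemma transport_edge:
  assumes "(v, w) \<in> E" "f \<in> F v"
  shows "transport v w f = act v w f"
proof -
  obtain e where e: "e \<in> K" "v \<in> e" "w \<in> e" "v \<in> V" "w \<in> V"
    using assms(1) by (auto simp: edge_rel_def edges_def)
  then obtain s where s: "flat e s" "s v = f" using flat_exists assms(2) by blast
  then have "act v w (s v) = s w" using assms(1) e unfolding flat_def by blast
  then show ?thesis using transport_flat[of e s v w] e s by simp
qed

section \<open>Transport along sequences of vertices\<close>

lemma carry_in:
  assumes "\<And>j. j \<le> M \<Longrightarrow> w j \<in> V" "\<And>j. j < M \<Longrightarrow> \<exists>d\<in>K. w j \<in> d \<and> w (Suc j) \<in> d" "f \<in> F (w 0)"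
  shows "j \<le> M \<Longrightarrow> carry transport w f j \<in> F (w j)"
proof (induction j)
  case (Suc j)
  then obtain d where "d \<in> K" "w j \<in> d" "w (Suc j) \<in> d" using assms(2)[of j] by auto
  with Suc show ?case using transport_in[of d "w j" "w (Suc j)"] assms(1) by simp
qed (use assms in simp)

text \<open>Transport around each small square of the grid is trivial; hence so is transport around
  the boundary.\<close>

lemma carry_grid:
  assumes wV: "\<And>i j. \<lbrakk>i \<le> M; j \<le> M\<rbrakk> \<Longrightarrow> w i j \<in> V"
    and cell: "\<And>i j. \<lbrakk>i \<le> M; j \<le> M\<rbrakk> \<Longrightarrow>
        \<exists>d\<in>K. \<forall>i'\<in>{i, Suc i}. \<forall>j'\<in>{j, Suc j}. i' \<le> M \<longrightarrow> j' \<le> M \<longrightarrow> w i' j' \<in> d"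
    and left: "\<And>i. i \<le> M \<Longrightarrow> w i 0 = u" and right: "\<And>i. i \<le> M \<Longrightarrow> w i M = u"
    and top: "\<And>j. j \<le> M \<Longrightarrow> w M j = u" and f: "f \<in> F u"
  shows "carry transport (w 0) f M = f"
proof -
  have uV: "u \<in> V" using wV[of 0 0] left[of 0] by simp
  have in_F: "carry transport (w i) f j \<in> F (w i j)" if "i \<le> M" "j \<le> M" for i j
  proof (rule carry_in[OF _ _ _ that(2)])
    show "\<exists>d\<in>K. w i j \<in> d \<and> w i (Suc j) \<in> d" if "j < M" for j
      using cell[of i j] \<open>i \<le> M\<close> that by auto
  qed (use wV left f that in auto)
  \<comment> \<open>Transport between consecutive rows commutes with carrying along the rows, one
    small square at a time. The left side, constantly \<open>u\<close>, starts the
    induction.\<close>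
  have step: "transport (w i j) (w (Suc i) j) (carry transport (w i) f j) = carry transport (w (Suc i)) f j"
    if i: "i < M" and "j \<le> M" for i j
    using \<open>j \<le> M\<close>
  proof (induction j)
    case 0
    then show ?case using left[of i] left[of "Suc i"] i transport_refl[OF uV f] by simp
  next
    case (Suc j)
    then obtain d where d: "d \<in> K" "w i j \<in> d" "w i (Suc j) \<in> d" "w (Suc i) j \<in> d" "w (Suc i) (Suc j) \<in> d"
      using cell[of i j] i by auto
    have V: "w i j \<in> V" "w i (Suc j) \<in> V" "w (Suc i) j \<in> V" "w (Suc i) (Suc j) \<in> V"
      using wV i Suc.prems by auto
    have fj: "carry transport (w i) f j \<in> F (w i j)" using in_F i Suc.prems by simp
    show ?case
      using transport_trans[OF d(1) V(1,2,4) d(2,3,5) fj] transport_trans[OF d(1) V(1,3,4) d(2,4,5) fj] Suc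
      by simp
  qed
  have "carry transport (w i) f M = carry transport (w 0) f M" if "i \<le> M" for i
    using that
  proof (induction i)
    case (Suc i)
    then have "transport u u (carry transport (w i) f M) = carry transport (w (Suc i)) f M"
      using step[of i M] right by simp
    moreover have "carry transport (w i) f M \<in> F u" using in_F[of i M] right[of i] Suc.prems by simp
    ultimately show ?case using transport_refl[OF uV] Suc by simp
  qed simp
  moreover have "carry transport (w M) f j = f" if "j \<le> M" for j
    using that by (induction j) (auto simp: top transport_refl[OF uV f])
  ultimately show ?thesis by (metis order_refl)
qed

text \<open>The index \<open>k * m + r\<close> stands for the \<open>r\<close>-th of \<open>m\<close> parts of the \<open>k\<close>-th edge of the walk.\<close>

lemma carry_subdivided_walk:
  assumes m: "m > 0"
    and walk: "\<And>k. k < n \<Longrightarrow> (v k, v (Suc k)) \<in> E \<and> f k \<in> F (v k) \<and> f (Suc k) = act (v k) (v (Suc k)) (f k)"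
    and e: "\<And>k. k < n \<Longrightarrow> e k \<in> K \<and> v k \<in> e k \<and> v (Suc k) \<in> e k"
    and w: "\<And>k r. \<lbrakk>k < n; r < m\<rbrakk> \<Longrightarrow> w (k * m + r) \<in> V \<inter> e k"
    and w_start: "\<And>k. k < n \<Longrightarrow> w (k * m) = v k"
    and w_end: "\<And>k. k < n \<Longrightarrow> w (k * m + (m - 1)) = v (Suc k)"
    and "k < n"
  shows "carry transport w (f 0) (k * m + (m - 1)) = f (Suc k)"
proof -
  have V: "v k \<in> V" "v (Suc k) \<in> V" if "k < n" for k
    using walk[OF that] by (auto simp: edge_rel_def)
  have row: "carry transport w (f 0) (k * m + r) = transport (v k) (w (k * m + r)) (f k)"
    if k: "k < n" and "r < m" and start: "carry transport w (f 0) (k * m) = f k" for k r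
    using \<open>r < m\<close>
  proof (induction r)
    case 0
    then show ?case using start w_start[OF k] transport_refl V(1)[OF k] walk[OF k] by simp
  next
    case (Suc r)
    then show ?case
      using transport_trans[of "e k" "v k" "w (k * m + r)" "w (k * m + Suc r)" "f k"]
        w[OF k, of r] w[OF k, of "Suc r"] e[OF k] V(1)[OF k] walk[OF k] by simp
  qed
  have last: "carry transport w (f 0) (k * m + (m - 1)) = f (Suc k)"
    if "k < n" "carry transport w (f 0) (k * m) = f k" for k
    using row[OF that(1) _ that(2), of "m - 1"] m w_end[OF that(1)] walk[OF that(1)] transport_edge by simp
  have "carry transport w (f 0) (k * m) = f k" if "k < n" for k
    using that
  proof (induction k)
    case (Suc k)
    then have "carry transport w (f 0) (k * m + (m - 1)) = f (Suc k)" using last by simp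
    \<comment> \<open>The vertex \<open>v (Suc k)\<close> occurs at the last index of block
      \<open>k\<close> and again at the first index of the next block, so the step between the
      blocks is trivial.\<close>
    moreover have eq: "Suc k * m = Suc (k * m + (m - 1))" using m by simp
    moreover have "w (Suc (k * m + (m - 1))) = v (Suc k)"
      using w_start[OF Suc.prems] unfolding eq .
    ultimately show ?case
      using w_end[of k] transport_refl V(1)[OF Suc.prems] walk[OF Suc.prems] Suc.prems
      unfolding eq by simp
  qed simp
  then show ?thesis using last \<open>k < n\<close> by blast
qed

end

end


section \<open>Stars of vertices and the absence of monodromy\<close>

lemma cube_topology_eq: "cube_topology n = top_of_set (unit_cube n)"
proof -
  have "unit_cube n \<subseteq> {x. \<forall>i\<ge>n. x i = 0}" by (auto simp: unit_cube_def)
  then have "{x. \<forall>i\<ge>n. x i = 0} \<inter> unit_cube n = unit_cube n" by (rule Int_absorb1)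
  then show ?thesis
    by (simp add: cube_topology_def Euclidean_space_def subtopology_subtopology euclidean_product_topology)
qed

lemma closed_Collect_coordinates: "closed {x :: nat \<Rightarrow> real. \<forall>i\<in>S. x i = g i}"
proof -
  have "closed {x :: nat \<Rightarrow> real. x i = g i}" for i
    by (intro closed_Collect_eq continuous_on_product_coordinates continuous_on_const)
  moreover have "{x. \<forall>i\<in>S. x i = g i} = (\<Inter>i\<in>S. {x :: nat \<Rightarrow> real. x i = g i})" by auto
  ultimately show ?thesis by auto
qed

lemma closedin_face: "closedin (cube_topology n) (face n A I)"
proof -
  have eq: "face n A I = unit_cube n \<inter> {x. \<forall>i\<in>{..<n} - I. x i = ind A i}"
    by (auto simp: face_def)
  show ?thesis
    unfolding cube_topology_eq eq by (rule closedin_closed_Int[OF closed_Collect_coordinates])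
qed

lemma segment_in_cube:
  assumes "A \<subseteq> {..<n}" "B \<subseteq> {..<n}" "t \<in> {0..1}"
  shows "(\<lambda>i. (1 - t) * ind A i + t * ind B i) \<in> unit_cube n"
proof -
  have "0 \<le> (1 - t) * ind A i + t * ind B i \<and> (1 - t) * ind A i + t * ind B i \<le> 1" for i
    using assms(3) by (auto simp: ind_def)
  moreover have "(1 - t) * ind A i + t * ind B i = 0" if "i \<ge> n" for i
    using assms(1,2) that by (auto simp: ind_def)
  ultimately show ?thesis by (simp add: unit_cube_def)
qed

section \<open>Open stars and connectedness\<close>

context cube_complex
begin

abbreviation X :: "'p topology" where
  "X \<equiv> complex_topology K cdim \<phi>"

lemma topspace_X: "topspace X = \<Union>K"
proof
  show "topspace X \<subseteq> \<Union>K" using openin_complex_topology[of K cdim \<phi> "topspace X"] by simp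
  have "{x \<in> unit_cube (cdim c). \<phi> c x \<in> \<Union>K} = unit_cube (cdim c)" if "c \<in> K" for c
    using \<phi>_image[OF that] that by blast
  then have "openin X (\<Union>K)" by (simp add: openin_complex_topology cube_topology_eq)
  then show "\<Union>K \<subseteq> topspace X" by (rule openin_subset)
qed

lemma continuous_map_\<phi>:
  assumes "c \<in> K"
  shows "continuous_map (cube_topology (cdim c)) X (\<phi> c)"
  unfolding continuous_map_def
proof (intro conjI allI impI)
  show "\<phi> c \<in> topspace (cube_topology (cdim c)) \<rightarrow> topspace X"
    using \<phi>_image[OF assms] assms by (auto simp: cube_topology_eq topspace_X)
  show "openin (cube_topology (cdim c)) {x \<in> topspace (cube_topology (cdim c)). \<phi> c x \<in> U}"
    if "openin X U" for U
    using that assms by (simp add: openin_complex_topology) (simp add: cube_topology_eq)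
qed

definition star :: "'p \<Rightarrow> 'p set" where
  "star v = \<Union>K - \<Union>{c \<in> K. v \<notin> c}"

lemma star_cell: "\<lbrakk>p \<in> star v; c \<in> K; p \<in> c\<rbrakk> \<Longrightarrow> v \<in> c"
  by (auto simp: star_def)

lemma star_vertex: "\<lbrakk>w \<in> star v; w \<in> V\<rbrakk> \<Longrightarrow> v = w"
  using star_cell[of w v "{w}"] by (simp add: vertices_def)

text \<open>Infinitely many cells may miss \<open>v\<close>, but they meet the cell \<open>c\<close>
  in only finitely many different faces. The preimage in its cube is the complement of a finite
  union of closed faces.\<close>

lemma open_star: "openin X (star v)"
  unfolding openin_complex_topology
proof (intro conjI ballI)
  fix c assume c: "c \<in> K"
  let ?n = "cdim c"
  let ?\<F> = "{G. (\<exists>A I. A \<subseteq> {..<?n} \<and> I \<subseteq> {..<?n} \<and> G = face ?n A I) \<and> v \<notin> \<phi> c ` G \<and> (\<exists>d\<in>K. v \<notin> d \<and> c \<inter> d = \<phi> c ` G)}"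
  have "?\<F> \<subseteq> (\<lambda>(A, I). face ?n A I) ` (Pow {..<?n} \<times> Pow {..<?n})" by auto
  then have "finite ?\<F>" by (rule finite_subset) simp
  then have closed: "closedin (cube_topology ?n) (\<Union>?\<F>)"
    by (intro closedin_Union) (auto intro: closedin_face)
  have "{x \<in> unit_cube ?n. \<phi> c x \<in> star v} = unit_cube ?n - \<Union>?\<F>"
  proof (intro equalityI subsetI)
    fix x assume x: "x \<in> {x \<in> unit_cube ?n. \<phi> c x \<in> star v}"
    have "x \<notin> G" if G: "G \<in> ?\<F>" for G
    proof
      assume "x \<in> G"
      obtain d where "d \<in> K" "v \<notin> d" "c \<inter> d = \<phi> c ` G" using G by blast
      with \<open>x \<in> G\<close> have "\<phi> c x \<in> d" by blast
      with x \<open>d \<in> K\<close> \<open>v \<notin> d\<close> show False using star_cell by blast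
    qed
    with x show "x \<in> unit_cube ?n - \<Union>?\<F>" by blast
  next
    fix x assume x: "x \<in> unit_cube ?n - \<Union>?\<F>"
    then have px: "\<phi> c x \<in> c" using \<phi>_image[OF c] by blast
    have "\<phi> c x \<notin> d" if d: "d \<in> K" "v \<notin> d" for d
    proof
      assume "\<phi> c x \<in> d"
      then have "c \<inter> d \<noteq> {}" using px by blast
      then obtain A I where AI: "A \<subseteq> {..<?n}" "I \<subseteq> {..<?n}" "c \<inter> d = \<phi> c ` face ?n A I"
        using inter_subcell[OF c d(1)] unfolding subcell_def by metis
      have "\<phi> c x \<in> \<phi> c ` face ?n A I" unfolding AI(3)[symmetric] using px \<open>\<phi> c x \<in> d\<close> by simp
      then have "x \<in> face ?n A I"
        using inj_on_image_mem_iff[OF \<phi>_inj[OF c] _ face_subset] x by simp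
      moreover have "v \<notin> \<phi> c ` face ?n A I" using AI(3) d(2) by blast
      then have "face ?n A I \<in> ?\<F>" using AI d by blast
      ultimately show False using x by (simp only: DiffD2 UnionI Diff_iff) blast
    qed
    then show "x \<in> {x \<in> unit_cube ?n. \<phi> c x \<in> star v}"
      using x px c unfolding star_def by blast
  qed
  then show "openin (cube_topology ?n) {x \<in> unit_cube ?n. \<phi> c x \<in> star v}"
    using openin_diff[OF openin_topspace closed] by (simp add: cube_topology_eq)
qed (auto simp: star_def)

text \<open>The cell of least dimension containing \<open>p\<close> lies in every other cell containing \<open>p\<close>.\<close>

lemma star_cover:
  assumes "p \<in> \<Union>K"
  obtains v where "v \<in> V" "p \<in> star v"
proof -
  obtain c where c: "c \<in> K" "p \<in> c" and min: "\<And>d. \<lbrakk>d \<in> K; p \<in> d\<rbrakk> \<Longrightarrow> cdim c \<le> cdim d"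
    using ex_has_least_nat[of "\<lambda>c. c \<in> K \<and> p \<in> c" _ cdim] assms by (metis UnionE)
  have "c \<subseteq> d" if d: "d \<in> K" "p \<in> d" for d
  proof -
    have "c \<inter> d \<noteq> {}" using c d by blast
    then obtain A I where AI: "A \<subseteq> {..<cdim c}" "I \<subseteq> {..<cdim c}" "c \<inter> d = subcell c A I"
      using inter_subcell[OF c(1) d(1)] by metis
    then have "cdim c \<le> card I"
      using min[of "subcell c A I"] subcell[OF c(1) AI(1,2)] c d by auto
    then have "I = {..<cdim c}" using AI(2) card_seteq[of "{..<cdim c}" I] by simp
    then have "c \<inter> d = c" using AI(3) subcell_whole[OF c(1)] by simp
    then show ?thesis by blast
  qed
  then have "corner c {} \<in> d" if "d \<in> K" "p \<in> d" for d
    using corner_in[OF c(1), of "{}"] that by blast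
  then have "p \<in> star (corner c {})" using c by (auto simp: star_def)
  then show ?thesis using that corner_vertex[OF c(1), of "{}"] by blast
qed

lemma corners_connected:
  assumes c: "c \<in> K" and B: "B \<subseteq> {..<cdim c}"
  shows "A \<subseteq> {..<cdim c} \<Longrightarrow> (corner c A, corner c B) \<in> E\<^sup>*"
proof (induction "card ((A - B) \<union> (B - A))" arbitrary: A rule: less_induct)
  case less
  show ?case
  proof (cases "A = B")
    case False
    then obtain i where i: "i \<in> (A - B) \<union> (B - A)" by blast
    then have "i < cdim c" using B less.prems by auto
    then have sub: "flip i A \<subseteq> {..<cdim c}" using less.prems by simp
    have fin: "finite ((A - B) \<union> (B - A))"
      using B less.prems finite_subset[of _ "{..<cdim c}"] by blast
    have "(flip i A - B) \<union> (B - flip i A) = ((A - B) \<union> (B - A)) - {i}"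
      using i by (auto simp: flip_def split: if_splits)
    then have "card ((flip i A - B) \<union> (B - flip i A)) < card ((A - B) \<union> (B - A))"
      using fin i by (metis card_Diff1_less)
    then have "(corner c (flip i A), corner c B) \<in> E\<^sup>*" using less.hyps sub by blast
    moreover have "(corner c A, corner c (flip i A)) \<in> E"
      using adjacent_corner_iff[OF c less.prems sub] \<open>i < cdim c\<close> by blast
    ultimately show ?thesis by simp
  qed simp
qed

text \<open>Stars that meet have their vertices in a common cell, whose corners are joined by edges.
  So the stars of the reachable vertices and those of the others would separate the space.\<close>

lemma vertices_connected:
  assumes "connected_space X" "u \<in> V" "v \<in> V"
  shows "(u, v) \<in> E\<^sup>*"
proof (rule ccontr)
  assume no: "(u, v) \<notin> E\<^sup>*"
  define S T where "S = \<Union>(star ` {w \<in> V. (u, w) \<in> E\<^sup>*})" and "T = \<Union>(star ` {w \<in> V. (u, w) \<notin> E\<^sup>*})"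
  have "openin X S" "openin X T" unfolding S_def T_def using open_star by auto
  moreover have "topspace X \<subseteq> S \<union> T"
    unfolding topspace_X S_def T_def using star_cover by blast
  moreover have "S \<inter> T = {}"
  proof (rule ccontr)
    assume "S \<inter> T \<noteq> {}"
    then obtain p w w' where p: "p \<in> star w" "p \<in> star w'" and w: "w \<in> V" "(u, w) \<in> E\<^sup>*"
      and w': "w' \<in> V" "(u, w') \<notin> E\<^sup>*"
      unfolding S_def T_def by blast
    then obtain c where c: "c \<in> K" "p \<in> c" by (auto simp: star_def)
    obtain A where A: "A \<subseteq> {..<cdim c}" "w = corner c A"
      using vertex_corner[OF w(1) star_cell[OF p(1) c] c(1)] by blast
    obtain B where B: "B \<subseteq> {..<cdim c}" "w' = corner c B"
      using vertex_corner[OF w'(1) star_cell[OF p(2) c] c(1)] by blast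
    have "(w, w') \<in> E\<^sup>*" using corners_connected[OF c(1) B(1) A(1)] A B by simp
    with w(2) w'(2) show False using rtrancl_trans by metis
  qed
  moreover have "w \<in> star w" if "w \<in> V" for w
  proof -
    have "w \<in> \<Union>K" using that by (auto simp: vertices_def)
    then show ?thesis using star_cover star_vertex that by metis
  qed
  then have "u \<in> star u" "v \<in> star v" using assms(2,3) by auto
  then have "u \<in> S" "v \<in> T" unfolding S_def T_def using assms(2,3) no by blast+
  then have "S \<noteq> {}" "T \<noteq> {}" by auto
  ultimately have "\<exists>S T. openin X S \<and> openin X T \<and> topspace X \<subseteq> S \<union> T \<and> S \<inter> T = {} \<and> S \<noteq> {} \<and> T \<noteq> {}"
    by (intro exI conjI)
  with assms(1) show False unfolding connected_space_def by (rule notE)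
qed

lemma cell_segment:
  assumes "c \<in> K" "A \<subseteq> {..<cdim c}" "B \<subseteq> {..<cdim c}"
  obtains q where "continuous_map (top_of_set {0..1}) X q" "\<And>t. t \<in> {0..1} \<Longrightarrow> q t \<in> c"
    "q (0::real) = corner c A" "q 1 = corner c B"
proof
  let ?s = "\<lambda>t i. (1 - t) * ind A i + t * ind B i"
  have "continuous_on {0..1} ?s"
    by (intro continuous_on_coordinatewise_then_product continuous_intros)
  then have "continuous_map (top_of_set {0..1}) (cube_topology (cdim c)) ?s"
    unfolding cube_topology_eq using segment_in_cube assms(2,3) by auto
  then show "continuous_map (top_of_set {0..1}) X (\<phi> c \<circ> ?s)"
    using continuous_map_\<phi>[OF assms(1)] by (rule continuous_map_compose)
  show "(\<phi> c \<circ> ?s) t \<in> c" if "t \<in> {0..1}" for t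
    using segment_in_cube[OF assms(2,3) that] \<phi>_image[OF assms(1)] by auto
qed (simp_all add: corner_def)

text \<open>The parameter interval grows with \<open>n\<close>, so a new segment is attached without
  rescaling the old part. The cells \<open>e k\<close> record where the segments run.\<close>

lemma walk_path:
  assumes "v 0 \<in> V" "\<And>k. k < n \<Longrightarrow> e k \<in> K \<and> v k \<in> V \<inter> e k \<and> v (Suc k) \<in> V \<inter> e k"
  shows "\<exists>p. continuous_map (top_of_set {0..real n}) X p \<and> (\<forall>k\<le>n. p (real k) = v k) \<and>
    (\<forall>k<n. \<forall>t\<in>{real k..real (Suc k)}. p t \<in> e k)"
  using assms(2)
proof (induction n)
  case 0
  have "v 0 \<in> topspace X" using assms(1) by (auto simp: topspace_X vertices_def)
  then show ?case by (intro exI[of _ "\<lambda>_. v 0"]) simp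
next
  case (Suc n)
  then obtain p where p: "continuous_map (top_of_set {0..real n}) X p" "\<And>k. k \<le> n \<Longrightarrow> p (real k) = v k"
    "\<And>k t. \<lbrakk>k < n; t \<in> {real k..real (Suc k)}\<rbrakk> \<Longrightarrow> p t \<in> e k" by auto
  have e: "e n \<in> K" "v n \<in> V" "v n \<in> e n" "v (Suc n) \<in> V" "v (Suc n) \<in> e n" using Suc.prems by auto
  obtain A where A: "A \<subseteq> {..<cdim (e n)}" "v n = corner (e n) A" using vertex_corner e by blast
  obtain B where B: "B \<subseteq> {..<cdim (e n)}" "v (Suc n) = corner (e n) B" using vertex_corner e by blast
  obtain q where q: "continuous_map (top_of_set {0..1}) X q" "\<And>t. t \<in> {0..1} \<Longrightarrow> q t \<in> e n"
    "q (0::real) = v n" "q 1 = v (Suc n)"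
    using cell_segment[OF e(1) A(1) B(1)] A(2) B(2) by metis
  define r where "r t = (if t \<le> real n then p t else q (t - real n))" for t
  let ?I = "top_of_set {0..real (Suc n)}"
  have "continuous_map ?I X r"
    unfolding r_def
  proof (rule continuous_map_cases_le)
    show "continuous_map ?I euclideanreal (\<lambda>t. t)" "continuous_map ?I euclideanreal (\<lambda>t. real n)"
      by simp_all
    have "{0..real (Suc n)} \<inter> {t \<in> topspace ?I. t \<le> real n} = {0..real n}" by auto
    then show "continuous_map (subtopology ?I {t \<in> topspace ?I. t \<le> real n}) X p"
      using p(1) by (simp add: subtopology_subtopology)
    have eq: "{0..real (Suc n)} \<inter> {t \<in> topspace ?I. real n \<le> t} = {real n..real (Suc n)}" by auto
    have "continuous_map (top_of_set {real n..real (Suc n)}) (top_of_set {0..1}) (\<lambda>t. t - real n)"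
      by (auto intro!: continuous_intros)
    then have "continuous_map (top_of_set {real n..real (Suc n)}) X (q \<circ> (\<lambda>t. t - real n))"
      using q(1) by (rule continuous_map_compose)
    then show "continuous_map (subtopology ?I {t \<in> topspace ?I. real n \<le> t}) X (\<lambda>t. q (t - real n))"
      using eq by (simp add: subtopology_subtopology o_def)
    show "p t = q (t - real n)" if "t = real n" for t
      using that p(2)[of n] q(3) by simp
  qed
  moreover have "r (real k) = v k" if "k \<le> Suc n" for k
    using that p(2)[of k] q(4) by (cases "k = Suc n") (auto simp: r_def)
  moreover have "r t \<in> e k" if "k < Suc n" "t \<in> {real k..real (Suc k)}" for k t
  proof (cases "k = n")
    case True
    then show ?thesis
      using that q(2)[of "t - real n"] e(3) p(2)[of n] by (cases "t = real n") (auto simp: r_def)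
  next
    case False
    then have "k < n" "t \<le> real n" using that by auto
    then show ?thesis using p(3) that(2) by (simp add: r_def)
  qed
  ultimately show ?case by (intro exI[of _ r]) blast
qed

end


context cube_complex
begin

text \<open>This is the Lebesgue number argument for the preimages of the stars. The number of
  subdivisions is a multiple of \<open>n\<close> so that the vertices of a walk with
  \<open>n\<close> edges fall on grid points.\<close>

lemma star_grid:
  assumes H: "continuous_map (top_of_set ({0..1} \<times> {0..1})) X H" and "n > 0"
  shows "\<exists>m>0. \<exists>w. \<forall>i<n * m. \<forall>j<n * m. w i j \<in> V \<and>
    (\<forall>s\<in>{real i / real (n * m)..real (Suc i) / real (n * m)}.
      \<forall>t\<in>{real j / real (n * m)..real (Suc j) / real (n * m)}. H (s, t) \<in> star (w i j))"
proof -
  define S :: "(real \<times> real) set" where "S = {0..1} \<times> {0..1}"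
  define C where "C = {T. open T \<and> (\<exists>v\<in>V. \<forall>x\<in>S \<inter> T. H x \<in> star v)}"
  have cover: "\<exists>T\<in>C. x \<in> T" if x: "x \<in> S" for x
  proof -
    have "H x \<in> \<Union>K" using H x topspace_X by (auto simp: continuous_map_def S_def)
    then obtain v where v: "v \<in> V" "H x \<in> star v" using star_cover by blast
    have "openin (top_of_set S) {y \<in> S. H y \<in> star v}"
      using openin_continuous_map_preimage[OF H open_star, of v] by (simp add: S_def)
    then obtain T where T: "open T" "{y \<in> S. H y \<in> star v} = S \<inter> T"
      by (auto simp: openin_open)
    then have "T \<in> C" unfolding C_def using v(1) by blast
    moreover have "x \<in> T" using T(2) x v(2) by blast
    ultimately show ?thesis by blast
  qed
  have "(0, 0) \<in> S" by (simp add: S_def)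
  then have "C \<noteq> {}" using cover by blast
  moreover have "S \<subseteq> \<Union>C" using cover by blast
  moreover have "compact S" unfolding S_def by (intro compact_Times compact_Icc)
  moreover have "open T" if "T \<in> C" for T using that by (simp add: C_def)
  ultimately obtain \<delta> where \<delta>: "\<delta> > 0" "\<And>T. \<lbrakk>T \<subseteq> S; diameter T < \<delta>\<rbrakk> \<Longrightarrow> \<exists>B\<in>C. T \<subseteq> B"
    by (metis Lebesgue_number_lemma)
  \<comment> \<open>A small square of side \<open>1 / L\<close> has diameter at most
    \<open>2 / L\<close>, which must be less than \<delta>.\<close>
  define m where "m = nat \<lceil>2 / \<delta>\<rceil> + 1"
  define L where "L = real (n * m)"
  have "2 / \<delta> < real m" unfolding m_def by linarith
  also have "real m \<le> L" unfolding L_def of_nat_le_iff using \<open>n > 0\<close> by (cases n) simp_all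
  finally have "2 / \<delta> < L" .
  moreover have "2 / \<delta> > 0" using \<delta>(1) by simp
  ultimately have "L > 0" by (rule less_trans[rotated])
  with \<open>2 / \<delta> < L\<close> \<delta>(1) have L: "2 / L < \<delta>" "L > 0" by (simp_all add: field_simps)
  define Q where "Q i j = {real i / L..real (Suc i) / L} \<times> {real j / L..real (Suc j) / L}" for i j :: nat
  have "\<exists>v\<in>V. \<forall>x\<in>Q i j. H x \<in> star v" if "i < n * m" "j < n * m" for i j
  proof -
    have le: "real (Suc i) \<le> L" "real (Suc j) \<le> L"
      unfolding L_def of_nat_le_iff using that by simp_all
    have unit: "{real k / L..real (Suc k) / L} \<subseteq> {0..1}" if "real (Suc k) \<le> L" for k
    proof -
      have "0 \<le> real k / L" "real (Suc k) / L \<le> 1" using that L(2) by simp_all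
      then show ?thesis by (intro atLeastatMost_subset_iff[THEN iffD2]) simp
    qed
    have Q: "Q i j \<subseteq> S" unfolding Q_def S_def by (intro Sigma_mono unit le)
    have near: "\<bar>x - y\<bar> \<le> 1 / L" if "x \<in> {real k / L..real (Suc k) / L}" "y \<in> {real k / L..real (Suc k) / L}" for x y k
    proof -
      have "real (Suc k) / L = real k / L + 1 / L" by (simp add: add_divide_distrib)
      with that show ?thesis by auto
    qed
    have "diameter (Q i j) \<le> 2 / L"
    proof (rule diameter_le)
      fix x y assume "x \<in> Q i j" "y \<in> Q i j"
      then have "\<bar>fst x - fst y\<bar> \<le> 1 / L" "\<bar>snd x - snd y\<bar> \<le> 1 / L"
        unfolding Q_def by (auto intro!: near)
      moreover have "norm (x - y) \<le> \<bar>fst x - fst y\<bar> + \<bar>snd x - snd y\<bar>"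
        using norm_Pair_le[of "fst x - fst y" "snd x - snd y"] by (simp flip: minus_prod_def)
      ultimately show "norm (x - y) \<le> 2 / L" by simp
    qed (use L(2) in auto)
    then have "diameter (Q i j) < \<delta>" using L(1) by linarith
    then obtain B where "B \<in> C" "Q i j \<subseteq> B" using \<delta>(2) Q by blast
    then show ?thesis using Q unfolding C_def by blast
  qed
  then obtain w where w: "\<And>i j. \<lbrakk>i < n * m; j < n * m\<rbrakk> \<Longrightarrow> w i j \<in> V \<and> (\<forall>x\<in>Q i j. H x \<in> star (w i j))"
    by metis
  have "m > 0" by (simp add: m_def)
  moreover have "\<forall>i<n * m. \<forall>j<n * m. w i j \<in> V \<and> (\<forall>s\<in>{real i / L..real (Suc i) / L}.
      \<forall>t\<in>{real j / L..real (Suc j) / L}. H (s, t) \<in> star (w i j))"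
    using w unfolding Q_def by simp
  ultimately show ?thesis unfolding L_def by (intro exI[of _ m] exI[of _ w] conjI)
qed

end

section \<open>Closed walks and global flat sections\<close>

context CAT0_cube_complex
begin

lemma null_homotopy:
  fixes p :: "real \<Rightarrow> 'p"
  assumes "continuous_map (top_of_set {0..1}) X p" "p 0 = p 1"
  obtains H :: "real \<times> real \<Rightarrow> 'p" where "continuous_map (top_of_set ({0..1} \<times> {0..1})) X H"
    "\<And>t. H (0, t) = p t" "\<And>t. H (1, t) = p 0"
    "\<And>s. s \<in> {0..1} \<Longrightarrow> H (s, 0) = p 0" "\<And>s. s \<in> {0..1} \<Longrightarrow> H (s, 1) = p 0"
proof -
  have "pathin X p \<and> p 0 = p 1" using assms by (simp add: pathin_def)
  with simply_connected have "homotopic_with (\<lambda>q. q 0 = p 0 \<and> q 1 = p 0) (top_of_set {0..1}) X p (\<lambda>_. p 0)"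
    unfolding simply_connected_space_def by (elim conjE allE[of _ p] mp) (intro conjI)
  then obtain H :: "real \<times> real \<Rightarrow> 'p" where *: "continuous_map (prod_topology (top_of_set {0..1}) (top_of_set {0..1})) X H \<and>
      (\<forall>t. H (0, t) = p t) \<and> (\<forall>t. H (1, t) = p 0) \<and> (\<forall>s\<in>{0..1}. H (s, 0) = p 0 \<and> H (s, 1) = p 0)"
    unfolding homotopic_with_def ..
  note H = conjunct1[OF *] conjunct2[OF *]
  have "continuous_map (top_of_set ({0..1} \<times> {0..1})) (prod_topology (top_of_set {0..1}) (top_of_set {0..1}))
      (\<lambda>x :: real \<times> real. (fst x, snd x))"
    by (intro continuous_map_pairedI) (auto intro!: continuous_intros)
  then have "continuous_map (top_of_set ({0..1} \<times> {0..1})) X (H \<circ> (\<lambda>x. (fst x, snd x)))"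
    using H(1) by (rule continuous_map_compose)
  then have "continuous_map (top_of_set ({0..1} \<times> {0..1})) X H" by (simp add: o_def)
  then show ?thesis using H(2) by (intro that[of H]) auto
qed

text \<open>A null-homotopy of the walk is cut into small squares, each labelled by a vertex whose
  star contains its image. The bottom row of labels follows the walk, the other three sides are
  constant, and neighbouring labels share a cell, so \<open>carry_grid\<close> applies.\<close>

lemma closed_walk_trivial:
  fixes F :: "'p \<Rightarrow> 'f set"
  assumes ls: "local_system E sq F act"
    and walk: "\<And>k. k < n \<Longrightarrow> (v k, v (Suc k)) \<in> E \<and> f k \<in> F (v k) \<and> f (Suc k) = act (v k) (v (Suc k)) (f k)"
    and closed: "v n = v 0"
  shows "f n = f 0"
proof (cases "n = 0")
  case False
  then have n: "n > 0" by simp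
  have v0: "v 0 \<in> V" using walk[OF n] by (simp add: edge_rel_def)
  have "\<exists>e. e \<in> K \<and> v k \<in> V \<inter> e \<and> v (Suc k) \<in> V \<inter> e" if "k < n" for k
    using walk[OF that] by (auto simp: edge_rel_def edges_def)
  then obtain e where e: "\<And>k. k < n \<Longrightarrow> e k \<in> K \<and> v k \<in> V \<inter> e k \<and> v (Suc k) \<in> V \<inter> e k" by metis
  obtain P where P: "continuous_map (top_of_set {0..real n}) X P" "\<And>k. k \<le> n \<Longrightarrow> P (real k) = v k"
    "\<And>k t. \<lbrakk>k < n; t \<in> {real k..real (Suc k)}\<rbrakk> \<Longrightarrow> P t \<in> e k"
    using walk_path[of v n e, OF v0 e] by blast
  define p where "p t = P (real n * t)" for t
  have "continuous_map (top_of_set {0..1}) (top_of_set {0..real n}) (\<lambda>t. real n * t)"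
    using n by (auto intro!: continuous_intros mult_left_le)
  then have "continuous_map (top_of_set {0..1}) X (P \<circ> (\<lambda>t. real n * t))"
    using P(1) by (rule continuous_map_compose)
  then have p: "continuous_map (top_of_set {0..1}) X p" by (simp add: p_def[abs_def] o_def)
  have p01: "p 0 = v 0" "p 1 = v 0" using P(2)[of 0] P(2)[of n] closed by (simp_all add: p_def)
  obtain H :: "real \<times> real \<Rightarrow> 'p"
    where H: "continuous_map (top_of_set ({0..1} \<times> {0..1})) X H" "\<And>t. H (0, t) = p t"
    "\<And>t. H (1, t) = v 0" "\<And>s. s \<in> {0..1} \<Longrightarrow> H (s, 0) = v 0" "\<And>s. s \<in> {0..1} \<Longrightarrow> H (s, 1) = v 0"
    using null_homotopy[OF p] p01 by metis
  obtain m w where m: "m > 0" and w: "\<forall>i<n * m. \<forall>j<n * m. w i j \<in> V \<and>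
    (\<forall>s\<in>{real i / real (n * m)..real (Suc i) / real (n * m)}.
      \<forall>t\<in>{real j / real (n * m)..real (Suc j) / real (n * m)}. H (s, t) \<in> star (w i j))"
    using star_grid[OF H(1) n] by (elim exE conjE)
  define L where "L = n * m"
  \<comment> \<open>There are \<open>L\<close> small squares in a row; \<open>M\<close> is the index
    of the last one.\<close>
  define M where "M = L - 1"
  have L: "L > 0" "L = Suc M" using n m by (auto simp: L_def M_def)
  define g where "g i = real i / real L" for i
  have wV: "w i j \<in> V" if "i < L" "j < L" for i j using w[folded L_def] that by simp
  have g: "g i \<in> {g j..g (Suc j)}" if "i = j \<or> i = Suc j" for i j
    using that by (auto simp: g_def divide_right_mono)
  have g01: "g i \<in> {0..1}" if "i \<le> L" for i using that L(1) by (auto simp: g_def)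
  have g_ends: "g 0 = 0" "g L = 1" using L(1) by (auto simp: g_def)
  have star: "H (g i', g j') \<in> star (w i j)"
    if "i < L" "j < L" "i' = i \<or> i' = Suc i" "j' = j \<or> j' = Suc j" for i j i' j'
    using w[folded L_def, folded g_def, rule_format, OF that(1,2), THEN conjunct2, rule_format,
        OF g[OF that(3)] g[OF that(4)]] .
  \<comment> \<open>A vertex lies in no star but its own, so a small square with a corner mapped to
    a vertex has this vertex as its label.\<close>
  have w_eq: "w i j = x" if "i < L" "j < L" "i' = i \<or> i' = Suc i" "j' = j \<or> j' = Suc j"
    "H (g i', g j') = x" "x \<in> V" for i j i' j' x
    using star[OF that(1-4)] star_vertex that(5,6) by simp
  have grid: "carry (transport F act) (w 0) (f 0) M = f 0"
  proof (rule carry_grid[OF ls])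
    show "w i j \<in> V" if "i \<le> M" "j \<le> M" for i j using wV that L(2) by simp
    show "\<exists>d\<in>K. \<forall>i'\<in>{i, Suc i}. \<forall>j'\<in>{j, Suc j}. i' \<le> M \<longrightarrow> j' \<le> M \<longrightarrow> w i' j' \<in> d"
      if ij: "i \<le> M" "j \<le> M" for i j
    proof -
      \<comment> \<open>The image of this grid point lies in the stars of all labels of the small
        squares around it, so any cell through the image contains these labels.\<close>
      have "(g (Suc i), g (Suc j)) \<in> {0..1} \<times> {0..1}" using g01 ij L(2) by simp
      then have "H (g (Suc i), g (Suc j)) \<in> \<Union>K"
        using H(1) topspace_X unfolding continuous_map_def by auto
      then obtain d where d: "d \<in> K" "H (g (Suc i), g (Suc j)) \<in> d" by blast
      have "w i' j' \<in> d" if "i' \<in> {i, Suc i}" "j' \<in> {j, Suc j}" "i' \<le> M" "j' \<le> M" for i' j'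
        using star_cell[OF star[of i' j' "Suc i" "Suc j"] d] that L(2) by auto
      then show ?thesis using d(1) by blast
    qed
    show "w i 0 = v 0" if "i \<le> M" for i
      using w_eq[of i 0 i 0] H(4)[OF g01[of i]] g_ends(1) v0 that L(2) by simp
    show "w i M = v 0" if "i \<le> M" for i
      using w_eq[of i M i L] H(5)[OF g01[of i]] g_ends(2) v0 that L(2) by simp
    show "w M j = v 0" if "j \<le> M" for j
      using w_eq[of M j L j] H(3) g_ends(2) v0 that L(2) by simp
    show "f 0 \<in> F (v 0)" using walk[OF n] by simp
  qed
  have g_scaled: "real n * g (k * m + r) = real k + real r / real m" for k r
    using n m by (simp add: g_def L_def field_simps)
  have lt: "k * m + r < L" if "k < n" "r < m" for k r
  proof -
    have "k * m + r < Suc k * m" using that(2) by simp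
    also have "\<dots> \<le> n * m" using that(1) by (intro mult_le_mono1) simp
    finally show ?thesis by (simp add: L_def)
  qed
  have bottom: "H (g 0, g j) = P (real n * g j)" for j using H(2) g_ends(1) by (simp add: p_def)
  have "carry (transport F act) (w 0) (f 0) ((n - 1) * m + (m - 1)) = f (Suc (n - 1))"
  proof (rule carry_subdivided_walk[OF ls m, where n = n and v = v and e = e])
    show "e k \<in> K \<and> v k \<in> e k \<and> v (Suc k) \<in> e k" if "k < n" for k using e[OF that] by blast
    show "w 0 (k * m + r) \<in> V \<inter> e k" if k: "k < n" "r < m" for k r
    proof -
      have "real n * g (k * m + r) \<in> {real k..real (Suc k)}"
        unfolding g_scaled using k(2) by simp
      then have "H (g 0, g (k * m + r)) \<in> e k" using P(3)[OF k(1)] bottom by simp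
      then have "w 0 (k * m + r) \<in> e k"
        using star_cell[OF star[of 0 "k * m + r" 0 "k * m + r"]] e[OF k(1)] lt[OF k] L(1) by simp
      then show ?thesis using wV[OF L(1) lt[OF k]] by simp
    qed
    show "w 0 (k * m) = v k" if k: "k < n" for k
    proof -
      have "H (g 0, g (k * m)) = v k" using bottom g_scaled[of k 0] P(2)[of k] k by simp
      then show ?thesis using w_eq[of 0 "k * m" 0 "k * m" "v k"] lt[OF k m] e[OF k] L(1) by simp
    qed
    \<comment> \<open>The label is determined at the right end of the last small square of the
      block, which is the grid point of \<open>v (Suc k)\<close>.\<close>
    show "w 0 (k * m + (m - 1)) = v (Suc k)" if k: "k < n" for k
    proof -
      have "k * m + (m - 1) < L" using lt[OF k, of "m - 1"] m by simp
      moreover have "H (g 0, g (Suc (k * m + (m - 1)))) = v (Suc k)"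
        using bottom[of "k * m + m"] g_scaled[of k m] P(2)[of "Suc k"] k m by (simp add: add.commute)
      ultimately show ?thesis
        using w_eq[of 0 "k * m + (m - 1)" 0 "Suc (k * m + (m - 1))" "v (Suc k)"] e[OF k] L(1) by simp
    qed
    show "n - 1 < n" using n by simp
  qed (fact walk)
  moreover have "(n - 1) * m + (m - 1) = M"
  proof -
    have "L = (n - 1) * m + m" using n by (cases n) (simp_all add: L_def)
    then show ?thesis using m by (simp add: M_def)
  qed
  ultimately show ?thesis using grid n by simp
qed simp

text \<open>\<open>W\<close> is the 1-skeleton of the covering described by the local system. By
  \<open>closed_walk_trivial\<close> each component meets every fibre at most once, so the component
  of \<open>(u, f)\<close> is the graph of the section.\<close>

lemma flat_section_exists:
  fixes F :: "'p \<Rightarrow> 'f set"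
  assumes ls: "local_system E sq F act" and connected: "\<And>u v. \<lbrakk>u \<in> V; v \<in> V\<rbrakk> \<Longrightarrow> (u, v) \<in> E\<^sup>*"
    and u: "u \<in> V" "f \<in> F u"
  shows "\<exists>s. s u = f \<and> (\<forall>(v, w)\<in>E. act v w (s v) = s w)"
proof -
  define W where "W = {((v, g), (w, h)). (v, w) \<in> E \<and> g \<in> F v \<and> h = act v w g}"
  have "sym W"
    unfolding W_def using E_sym act_in[OF ls] act_back[OF ls] by (intro symI) auto
  then have symW: "(y, x) \<in> W\<^sup>*" if "(x, y) \<in> W\<^sup>*" for x y
    using that sym_rtrancl by (metis symD)
  have closed: "g = h" if "((v, g), (v, h)) \<in> W\<^sup>*" for v g h
  proof -
    obtain n where "((v, g), (v, h)) \<in> W ^^ n" using \<open>((v, g), (v, h)) \<in> W\<^sup>*\<close> rtrancl_imp_relpow by blast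
    then obtain x where x: "x 0 = (v, g)" "x n = (v, h)" "\<And>i. i < n \<Longrightarrow> (x i, x (Suc i)) \<in> W"
      unfolding relpow_fun_conv by blast
    have "snd (x n) = snd (x 0)"
      by (rule closed_walk_trivial[OF ls, of n "fst \<circ> x"])
        (use x in \<open>auto simp: W_def case_prod_unfold\<close>)
    then show ?thesis using x by simp
  qed
  have reach: "\<exists>g\<in>F v. ((u, f), (v, g)) \<in> W\<^sup>*" if "v \<in> V" for v
    using connected[OF u(1) that]
  proof (induction rule: rtrancl_induct)
    case (step v w)
    then obtain g where g: "g \<in> F v" "((u, f), (v, g)) \<in> W\<^sup>*" by blast
    then have "((v, g), (w, act v w g)) \<in> W" using step by (simp add: W_def)
    then show ?case using g act_in[OF ls step(2)] rtrancl_into_rtrancl by metis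
  qed (use u in auto)
  then obtain s where s: "\<And>v. v \<in> V \<Longrightarrow> s v \<in> F v \<and> ((u, f), (v, s v)) \<in> W\<^sup>*" by metis
  have unique: "g = h" if "((u, f), (v, g)) \<in> W\<^sup>*" "((u, f), (v, h)) \<in> W\<^sup>*" for v g h
    using closed rtrancl_trans[OF symW[OF that(1)] that(2)] .
  have "s u = f" using unique[of u] s[OF u(1)] by blast
  moreover have "act v w (s v) = s w" if "(v, w) \<in> E" for v w
  proof -
    have V: "v \<in> V" "w \<in> V" using that by (auto simp: edge_rel_def)
    have "((v, s v), (w, act v w (s v))) \<in> W" using that s[OF V(1)] by (simp add: W_def)
    then have "((u, f), (w, act v w (s v))) \<in> W\<^sup>*" using s[OF V(1)] rtrancl_into_rtrancl by metis
    then show ?thesis using unique s[OF V(2)] by blast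
  qed
  ultimately show ?thesis by (intro exI[of _ s]) auto
qed

lemma one_skeleton_connected: "\<lbrakk>u \<in> V; v \<in> V\<rbrakk> \<Longrightarrow> (u, v) \<in> E\<^sup>*"
  using vertices_connected simply_connected path_connected_imp_connected_space
  unfolding simply_connected_space_def by blast

sublocale simply_connected_square_graph E sq V
proof
  show "E \<subseteq> V \<times> V" by (auto simp: edge_rel_def)
qed (use one_skeleton_connected flat_section_exists in auto)

end

theorem proposition4p1:
  fixes K :: "'p set set"
    and cdim :: "'p set \<Rightarrow> nat"
    and \<phi> :: "'p set \<Rightarrow> (nat \<Rightarrow> real) \<Rightarrow> 'p"
  assumes "CAT0_cube_complex K cdim \<phi>"
    and "finite_dimensional K cdim"
  shows "property_A (vertices K cdim) (edge_path_metric K cdim)"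
proof -
  interpret CAT0_cube_complex K cdim \<phi> by fact
  obtain N where N: "\<And>c. c \<in> K \<Longrightarrow> cdim c \<le> N"
    using assms(2) unfolding finite_dimensional_def by blast
  interpret median_graph_of_bounded_dimension E sq V N
  proof (unfold_locales, goal_cases)
    case (1 S x)
    then show ?case by (rule sq_card_le) (rule N)
  qed
  have "edge_path_metric K cdim = (\<lambda>u v. real (graph_dist E u v))"
    by (simp add: fun_eq_iff edge_path_metric_def graph_dist_def)
  then show ?thesis using property_A_gd by simp
qed

end
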